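(* Let $\varepsilon \in (0,1)$. Then, for every constant $K \in (0,\infty)$, there exist a real-valued trigonometric polynomial $f$ of period $1$ with mean zero, $f \not\equiv 0$, and a lacunary sequence $(n_k)_{k \geq 1}$ of positive integers such that both of the following hold. (1) For all $a,b \in \mathbb{N}$ with $a \neq b$, $$ L(N,a,b,c) = \mathcal{O}\left( \frac{N}{(\log N)^{1-\varepsilon}} \right) \quad (N \to \infty), \qquad \text{uniformly in } c \in \mathbb{Z}_{\geq 0}, $$ i.e. for each fixed pair $a \ne b$ there is a constant $C$ (which may depend on $a,b$ but not on $c$ or $N$) such that $L(N,a,b,c) \leq C N/(\log N)^{1-\varepsilon}$ for all $N \geq 2$ and all integers $c \geq 0$. (2) For almost every $x \in [0,1]$ (with respect to Lebesgue measure), $$ \limsup_{N \to \infty} \frac{\left| \sum_{k=1}^N f(n_k x) \right|}{\sqrt{2 N \log\log N}} \geq K \|f\|_2 . $$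
   Context: A sequence $(n_k)_{k\ge1}$ of positive integers is called lacunary if it satisfies the Hadamard gap condition: there is a constant $q>1$ with $n_{k+1}/n_k \geq q$ for all $k \in \mathbb{N}$. For such a sequence, and $N,a,b \in \mathbb{N}$, $c \in \mathbb{Z}_{\geq 0}$, $$L(N,a,b,c) := \#\{(k,\ell) : 1 \leq k,\ell \leq N,\ a n_k - b n_\ell = c\}.$$ A trigonometric polynomial of period $1$ is a finite linear combination of the functions $\cos(2\pi j x)$, $\sin(2\pi j x)$, $j \in \mathbb{Z}_{\geq 0}$; it has mean zero if $\int_0^1 f(x)\,dx = 0$. The norm is $\|f\|_2 = \left(\int_0^1 f(x)^2\,dx\right)^{1/2}$. *)

theory Defs
  imports "HOL-Analysis.Analysis"
begin

text \<open>
  Sequences \<open>(n\<^sub>k)\<close> are indexed by \<open>k \<ge> 1\<close>; the value \<open>n 0\<close> is never used.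
\<close>

definition pos_seq :: "(nat \<Rightarrow> nat) \<Rightarrow> bool" where
  "pos_seq n \<longleftrightarrow> (\<forall>k\<ge>1. n k > 0)"

definition lacunary :: "(nat \<Rightarrow> nat) \<Rightarrow> bool" where
  "lacunary n \<longleftrightarrow> pos_seq n \<and> (\<exists>q::real. q > 1 \<and> (\<forall>k\<ge>1. real (n (k + 1)) / real (n k) \<ge> q))"

text \<open>The difference is taken in the integers, to avoid truncated subtraction.\<close>

definition L_count :: "(nat \<Rightarrow> nat) \<Rightarrow> nat \<Rightarrow> nat \<Rightarrow> nat \<Rightarrow> nat \<Rightarrow> nat" where
  "L_count n N a b c =
     card {(k, l). k \<in> {1..N} \<and> l \<in> {1..N} \<and> int a * int (n k) - int b * int (n l) = int c}"

definition trig_poly :: "(real \<Rightarrow> real) \<Rightarrow> bool" where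
  "trig_poly f \<longleftrightarrow>
     (\<exists>(d::nat) (\<alpha>::nat \<Rightarrow> real) (\<beta>::nat \<Rightarrow> real).
        \<forall>x. f x = (\<Sum>j\<le>d. \<alpha> j * cos (2 * pi * real j * x) + \<beta> j * sin (2 * pi * real j * x)))"

definition mean_zero :: "(real \<Rightarrow> real) \<Rightarrow> bool" where
  "mean_zero f \<longleftrightarrow> integral {0..1} f = 0"

definition norm_2 :: "(real \<Rightarrow> real) \<Rightarrow> real" where
  "norm_2 f = sqrt (integral {0..1} (\<lambda>x. (f x)\<^sup>2))"

end

theory Submission
  imports Defs
begin

text \<open>
  Take \<open>f x = \<Sum>j<d. cos (2 \<pi> 2^j x)\<close> and a sequence made of short runs \<open>2^(e+s) + c\<close>, \<open>s < 2 d\<close>, with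
  exponents \<open>e\<close> growing very quickly from run to run. Within a run \<open>2 n\<^sub>k - n\<^bsub>k+1\<^esub> = c\<close>, and at points \<open>x\<close>
  for which all \<open>2^j c x\<close> are close to integers the terms of a run interfere as those of the sequence
  \<open>2^s\<close> would, which increases the variance by a factor of order \<open>d\<close>. At the scale of
  \<open>N \<approx> (m!)\<^sup>2\<close> terms the offsets are \<open>c = i T\<close> with \<open>i\<close> ranging over about \<open>m^(1-\<epsilon>/2)\<close> values,
  each being used equally often. Hence no offset occurs more than \<open>N / (log N)^(1-\<epsilon>)\<close> times, whereas
  all of them are simultaneously resonant at \<open>x\<close> as soon as \<open>T x\<close> is within about \<open>m^(\<epsilon>/2-1)\<close> of an
  integer. On that event the sum exceeds \<open>K \<parallel>f\<parallel> sqrt (2 N log log N)\<close> with conditional probability at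
  least of order \<open>m^(-\<epsilon>/2)\<close>: cut the sum into about \<open>log m\<close> independent groups, each of which is of the size of its
  standard deviation with probability at least \<open>1/20\<close>. The probabilities of these events at the different scales
  add up to infinity and the events are nearly independent, so almost every \<open>x\<close> lies in infinitely
  many of them; the contribution of the previous scales is negligible by Chebyshev's inequality.
\<close>

section \<open>Trigonometric polynomials with separated frequencies\<close>

text \<open>The offsets pull in two directions: more values lower the counts \<open>L\<close>, but
  demand more zero digits of \<open>x\<close> and so shrink the resonant set. With
  \<open>2 ^ g m\<close> of order \<open>m^(1-\<epsilon>/2)\<close> both sides fit:
  \<open>log N\<close> is of order \<open>m log m\<close>, and the half of \<open>\<epsilon>\<close>
  given away absorbs the factor \<open>log m\<close>. The growth \<open>(m!)^2\<close> is likewise a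
  compromise: the ratios of successive scales must be summable for the past to be discarded almost
  everywhere, while \<open>log N\<close> must stay close to \<open>m\<close>.

  No limit theorem is needed. The crude bound 1/20 per group and all other lost constants are paid
  for by \<open>d\<close>, because the variance gain makes the required number of groups
  proportional to \<open>1/d\<close>.

  Near independence takes the form of lower bounds for probabilities conditional on the earlier
  binary digits of \<open>x\<close>. To this end each run owns a wide window of digits with its
  leading exponent in the middle: before the exponent the offset terms have already become constant
  phases, and at the end of the window the whole run has become nearly constant, so that its event
  may be replaced by a union of dyadic intervals.\<close>

inductive tpoly :: "int set \<Rightarrow> (real \<Rightarrow> real) \<Rightarrow> bool" for S where
  cos: "j \<in> S \<Longrightarrow> tpoly S (\<lambda>x. cos (2 * pi * of_int j * x + t))"
| zero: "tpoly S (\<lambda>x. 0)"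
| add: "tpoly S f \<Longrightarrow> tpoly S g \<Longrightarrow> tpoly S (\<lambda>x. f x + g x)"
| scale: "tpoly S f \<Longrightarrow> tpoly S (\<lambda>x. c * f x)"

lemma tpoly_mono: "tpoly S f \<Longrightarrow> S \<subseteq> T \<Longrightarrow> tpoly T f"
  by (induction rule: tpoly.induct) (auto intro: tpoly.intros)

lemma tpoly_sum: "(\<And>i. i \<in> I \<Longrightarrow> tpoly S (f i)) \<Longrightarrow> tpoly S (\<lambda>x. \<Sum>i\<in>I. f i x)"
  by (induction I rule: infinite_finite_induct) (auto intro: tpoly.intros)

lemma tpoly_continuous: "tpoly S f \<Longrightarrow> continuous_on A f"
  by (induction rule: tpoly.induct) (auto intro!: continuous_intros)

lemma tpoly_integrable: "tpoly S f \<Longrightarrow> f integrable_on {0..1}"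
  by (intro integrable_continuous_interval tpoly_continuous)

lemma has_integral_cos_period:
  "((\<lambda>x. cos (2 * pi * of_int j * x + t)) has_integral (if j = 0 then cos t else 0)) {0..1}"
proof (cases "j = 0")
  case True
  then show ?thesis using has_integral_const_real[of "cos t" 0 1] by simp
next
  case False
  define F where "F x = sin (2 * pi * of_int j * x + t) / (2 * pi * of_int j)" for x :: real
  have "((\<lambda>x. cos (2 * pi * of_int j * x + t)) has_integral (F 1 - F 0)) {0..1}"
  proof (rule fundamental_theorem_of_calculus)
    show "(F has_vector_derivative cos (2 * pi * of_int j * x + t)) (at x within {0..1})" for x
      unfolding F_def has_real_derivative_iff_has_vector_derivative[symmetric]
      using False by (auto intro!: derivative_eq_intros)
  qed simp
  moreover have "sin (2 * pi * of_int j + t) = sin t"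
    using sin_cos_eq_iff[of "2 * pi * of_int j + t" t]
    by (simp add: sin_add mult.assoc) 
  ultimately show ?thesis using False by (simp add: F_def)
qed

text \<open>Arbitrary phases make the cosines closed under products: only sums and differences of
  frequencies matter, and \<open>U\<close> may be any set containing them.\<close>

lemma tpoly_mult:
  assumes "tpoly S f" "tpoly T g" and U: "\<And>s t. s \<in> S \<Longrightarrow> t \<in> T \<Longrightarrow> s + t \<in> U \<and> s - t \<in> U"
  shows "tpoly U (\<lambda>x. f x * g x)"
  using assms(1)
proof induction
  case (cos j t)
  show ?case
    using assms(2)
  proof induction
    case (cos i u)
    have "cos (2 * pi * of_int j * x + t) * cos (2 * pi * of_int i * x + u)
      = (1/2) * (cos (2 * pi * of_int (j - i) * x + (t - u)) + cos (2 * pi * of_int (j + i) * x + (t + u)))" for x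
      unfolding cos_times_cos by (simp add: algebra_simps)
    then have eq: "(\<lambda>x. cos (2 * pi * of_int j * x + t) * cos (2 * pi * of_int i * x + u))
      = (\<lambda>x. (1/2) * (cos (2 * pi * of_int (j - i) * x + (t - u)) + cos (2 * pi * of_int (j + i) * x + (t + u))))"
      by blast
    show ?case
      unfolding eq by (intro tpoly.scale tpoly.add tpoly.cos) (use U[OF \<open>j \<in> S\<close> \<open>i \<in> T\<close>] in auto)
  next
    case (add f g)
    then show ?case using tpoly.add[OF add.IH] by (simp add: algebra_simps)
  next
    case (scale f c)
    then show ?case using tpoly.scale[OF scale.IH, of c] by (simp add: algebra_simps)
  qed (auto intro: tpoly.intros)
next
  case (add f h)
  then show ?case using tpoly.add[OF add.IH] by (simp add: algebra_simps)
next
  case (scale f c)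
  then show ?case using tpoly.scale[OF scale.IH, of c] by (simp add: algebra_simps)
qed (auto intro: tpoly.intros)

lemma tpoly_integral_0:
  assumes "tpoly S f" "0 \<notin> S" shows "integral {0..1} f = 0"
proof -
  have "(f has_integral 0) {0..1}"
    using assms(1)
  proof induction
    case (cos j t)
    then have "j \<noteq> 0" using assms(2) by auto
    then show ?case using has_integral_cos_period[of j t] by simp
  next
    case (add f g)
    then show ?case using has_integral_add[OF add.IH] by simp
  next
    case (scale f c)
    then show ?case using has_integral_mult_right[OF scale.IH, of c] by simp
  qed simp
  then show ?thesis by (rule integral_unique)
qed

lemma tpoly_split_mean:
  assumes "tpoly S f" shows "\<exists>h. tpoly (S - {0}) h \<and> (\<forall>x. f x = integral {0..1} f + h x)"
proof -
  have "\<exists>h c. tpoly (S - {0}) h \<and> f = (\<lambda>x. c + h x)"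
    using assms
  proof induction
    case (cos j t)
    show ?case
    proof (cases "j = 0")
      case True
      then show ?thesis using tpoly.zero by (intro exI[of _ "\<lambda>x. 0"] exI[of _ "cos t"]) auto
    next
      case False
      then show ?thesis using cos
        by (intro exI[of _ "\<lambda>x. cos (2 * pi * of_int j * x + t)"] exI[of _ 0]) (auto intro: tpoly.intros)
    qed
  next
    case zero
    then show ?case by (intro exI[of _ "\<lambda>x. 0"] exI[of _ 0]) (auto intro: tpoly.intros)
  next
    case (add f g)
    then obtain h c h' c' where "tpoly (S - {0}) h" "f = (\<lambda>x. c + h x)" "tpoly (S - {0}) h'" "g = (\<lambda>x. c' + h' x)"
      by blast
    then show ?case by (intro exI[of _ "\<lambda>x. h x + h' x"] exI[of _ "c + c'"]) (auto intro: tpoly.intros)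
  next
    case (scale f c)
    then obtain h e where "tpoly (S - {0}) h" "f = (\<lambda>x. e + h x)"
      by blast
    then show ?case by (intro exI[of _ "\<lambda>x. c * h x"] exI[of _ "c * e"]) (auto intro: tpoly.intros simp: algebra_simps)
  qed
  then obtain h c where h: "tpoly (S - {0}) h" "f = (\<lambda>x. c + h x)" by blast
  have "(f has_integral (c + integral {0..1} h)) {0..1}"
    unfolding h(2) using has_integral_const_real[of c 0 1] integrable_integral[OF tpoly_integrable[OF h(1)]]
    by (intro has_integral_add) auto
  then have "integral {0..1} f = c"
    using tpoly_integral_0[OF h(1)] by (simp add: integral_unique)
  then show ?thesis using h by auto
qed

text \<open>After the mean of \<open>g\<close> is split off, every frequency \<open>s + t\<close> or
  \<open>s - t\<close> of the remaining product is nonzero because \<open>t\<close> dominates.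
  Frequency 0 is allowed in \<open>T\<close> since \<open>g\<close> will also be the square of a
  summand, whose mean does not vanish.\<close>

lemma tpoly_integral_mult:
  assumes f: "tpoly S f" and g: "tpoly T g" and "\<And>s t. s \<in> S \<Longrightarrow> t \<in> T \<Longrightarrow> t \<noteq> 0 \<Longrightarrow> \<bar>s\<bar> < \<bar>t\<bar>"
  shows "integral {0..1} (\<lambda>x. f x * g x) = integral {0..1} f * integral {0..1} g"
proof -
  obtain h where h: "tpoly (T - {0}) h" "\<And>x. g x = integral {0..1} g + h x"
    using tpoly_split_mean[OF g] by blast
  define c where "c = integral {0..1} g"
  have fh: "tpoly {j. j \<noteq> 0} (\<lambda>x. f x * h x)"
    by (rule tpoly_mult[OF f h(1)]) (use assms(3) in force)
  have "(\<lambda>x. f x * g x) = (\<lambda>x. f x * c + f x * h x)"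
    using h(2) by (auto simp: c_def algebra_simps)
  then have "integral {0..1} (\<lambda>x. f x * g x) = integral {0..1} (\<lambda>x. f x * c + f x * h x)" by simp
  also have "\<dots> = integral {0..1} (\<lambda>x. f x * c) + integral {0..1} (\<lambda>x. f x * h x)"
    by (intro Henstock_Kurzweil_Integration.integral_add tpoly_integrable[OF fh] integrable_on_mult_left tpoly_integrable[OF f])
  also have "integral {0..1} (\<lambda>x. f x * h x) = 0"
    by (rule tpoly_integral_0[OF fh]) simp
  finally show ?thesis by (simp add: c_def)
qed

text \<open>
  Three factors from the first \<open>r\<close> summands cannot reach the nonzero frequencies of the next one, so
  up to fourth moments the summands behave like independent centred random variables.
\<close>

lemma tpoly_sum_moments:
  fixes X :: "nat \<Rightarrow> real \<Rightarrow> real" and Q :: "nat \<Rightarrow> int"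
  assumes X: "\<And>r. r < n \<Longrightarrow> tpoly {j. Q r dvd j \<and> 3 * \<bar>j\<bar> < Q (Suc r)} (X r)"
    and mean: "\<And>r. r < n \<Longrightarrow> integral {0..1} (X r) = 0"
    and Q: "\<And>r. r < n \<Longrightarrow> 0 < Q r \<and> Q r \<le> Q (Suc r)"
    and bd: "\<And>r x. r < n \<Longrightarrow> \<bar>X r x\<bar> \<le> M"
  defines "Z \<equiv> \<lambda>k x. \<Sum>r<k. X r x"
  shows "tpoly {j. 3 * \<bar>j\<bar> < Q n} (Z n) \<and> integral {0..1} (Z n) = 0
    \<and> integral {0..1} (\<lambda>x. (Z n x)\<^sup>2) = (\<Sum>r<n. integral {0..1} (\<lambda>x. (X r x)\<^sup>2))
    \<and> integral {0..1} (\<lambda>x. (Z n x)^4) \<le> 3 * (integral {0..1} (\<lambda>x. (Z n x)\<^sup>2))\<^sup>2 + real n * M^4"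
  using X mean Q bd
proof (induction n)
  case 0
  then show ?case unfolding Z_def by (auto intro: tpoly.intros)
next
  case (Suc n)
  define z x where "z = Z n" and "x = X n"
  have IH: "tpoly {j. 3 * \<bar>j\<bar> < Q n} z" "integral {0..1} z = 0"
    "integral {0..1} (\<lambda>t. (z t)\<^sup>2) = (\<Sum>r<n. integral {0..1} (\<lambda>x. (X r x)\<^sup>2))"
    "integral {0..1} (\<lambda>x. (z x)^4) \<le> 3 * (integral {0..1} (\<lambda>x. (z x)\<^sup>2))\<^sup>2 + real n * M^4"
    using Suc unfolding z_def by auto
  have Zx: "Z (Suc n) = (\<lambda>t. z t + x t)" by (auto simp: Z_def z_def x_def)
  have Qn: "0 < Q n" "Q n \<le> Q (Suc n)" using Suc.prems(3)[of n] by auto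
  have tx: "tpoly {j. Q n dvd j \<and> 3 * \<bar>j\<bar> < Q (Suc n)} x" using Suc.prems(1) x_def by auto
  have x0: "integral {0..1} x = 0" using Suc.prems(2) x_def by auto
  have x1: "tpoly {j. Q n dvd j} x" by (rule tpoly_mono[OF tx]) auto
  have x2: "tpoly {j. Q n dvd j} (\<lambda>t. x t * x t)" by (rule tpoly_mult[OF x1 x1]) auto
  have x3: "tpoly {j. Q n dvd j} (\<lambda>t. x t * (x t * x t))" by (rule tpoly_mult[OF x1 x2]) auto
  have tri: "3 * \<bar>s + t\<bar> < c" "3 * \<bar>s - t\<bar> < c" if "3 * \<bar>s\<bar> < a" "3 * \<bar>t\<bar> < b" "c = a + b" for s t a b c :: int
    using that abs_triangle_ineq[of s t] abs_triangle_ineq4[of s t] by (smt (verit))+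
  have z2: "tpoly {j. 3 * \<bar>j\<bar> < 2 * Q n} (\<lambda>t. z t * z t)" by (rule tpoly_mult[OF IH(1) IH(1)]) (simp add: tri)
  \<comment> \<open>The factor 3 in the frequency condition serves this cube: its frequencies stay
    below \<open>Q n\<close>, hence below every nonzero frequency of the powers of
    \<open>x\<close>.\<close>
  have z3: "tpoly {j. 3 * \<bar>j\<bar> < 3 * Q n} (\<lambda>t. z t * (z t * z t))" 
  proof (rule tpoly_mult[OF IH(1) z2])
    fix s t assume "s \<in> {j. 3 * \<bar>j\<bar> < Q n}" "t \<in> {j. 3 * \<bar>j\<bar> < 2 * Q n}"
    then show "s + t \<in> {j. 3 * \<bar>j\<bar> < 3 * Q n} \<and> s - t \<in> {j. 3 * \<bar>j\<bar> < 3 * Q n}"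
      using tri[of s "Q n" t "2 * Q n" "3 * Q n"] by simp
  qed
  have sep: "\<bar>s\<bar> < \<bar>t\<bar>" if "\<bar>s\<bar> < Q n" "Q n dvd t" "t \<noteq> 0" for s t
    using that Qn(1) by (meson dvd_imp_le_int le_less_trans less_le_trans order.refl abs_ge_self)
  note I = tpoly_integral_mult
  have zx: "integral {0..1} (\<lambda>t. z t * x t) = 0"
    by (subst I[OF IH(1) x1]) (use x0 Qn(1) in \<open>auto intro!: sep\<close>)
  have z3x: "integral {0..1} (\<lambda>t. (z t * (z t * z t)) * x t) = 0"
    by (subst I[OF z3 x1]) (use x0 Qn(1) in \<open>auto intro!: sep\<close>)
  have zx3: "integral {0..1} (\<lambda>t. z t * (x t * (x t * x t))) = 0"
    by (subst I[OF IH(1) x3]) (use IH(2) Qn(1) in \<open>auto intro!: sep\<close>)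
  have z2x2: "integral {0..1} (\<lambda>t. (z t * z t) * (x t * x t)) = integral {0..1} (\<lambda>t. z t * z t) * integral {0..1} (\<lambda>t. x t * x t)"
    by (rule I[OF z2 x2]) (use Qn(1) in \<open>auto intro!: sep\<close>)
  note c = tpoly_continuous[OF IH(1), of "{0..1}"] tpoly_continuous[OF x1, of "{0..1}"]
  have cc: "(\<lambda>t. z t * x t) integrable_on {0..1}" "(\<lambda>t. z t * z t) integrable_on {0..1}" "(\<lambda>t. x t * x t) integrable_on {0..1}"
    by (intro integrable_continuous_interval continuous_intros c)+
  have sq: "integral {0..1} (\<lambda>t. (z t + x t)\<^sup>2) = integral {0..1} (\<lambda>t. (z t)\<^sup>2) + integral {0..1} (\<lambda>t. (x t)\<^sup>2)"
  proof -
    have "((\<lambda>t. (z t * z t + 2 * (z t * x t)) + x t * x t) has_integral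
      (integral {0..1} (\<lambda>t. z t * z t) + 2 * 0) + integral {0..1} (\<lambda>t. x t * x t)) {0..1}"
      using cc[THEN integrable_integral] zx by (intro has_integral_add has_integral_mult_right) auto
    then show ?thesis by (intro integral_unique) (simp add: power2_eq_square algebra_simps)
  qed
  have cd: "(\<lambda>t. z t * (z t * (z t * z t))) integrable_on {0..1}" "(\<lambda>t. (z t * (z t * z t)) * x t) integrable_on {0..1}"
     "(\<lambda>t. (z t * z t) * (x t * x t)) integrable_on {0..1}" "(\<lambda>t. z t * (x t * (x t * x t))) integrable_on {0..1}"
     "(\<lambda>t. x t * (x t * (x t * x t))) integrable_on {0..1}"
    by (intro integrable_continuous_interval continuous_intros c)+
  have quart: "integral {0..1} (\<lambda>t. (z t + x t)^4) = integral {0..1} (\<lambda>t. (z t)^4)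
     + 6 * (integral {0..1} (\<lambda>t. (z t)\<^sup>2) * integral {0..1} (\<lambda>t. (x t)\<^sup>2)) + integral {0..1} (\<lambda>t. (x t)^4)"
  proof -
    have "((\<lambda>t. (((z t * (z t * (z t * z t)) + 4 * ((z t * (z t * z t)) * x t)) + 6 * ((z t * z t) * (x t * x t)))
        + 4 * (z t * (x t * (x t * x t)))) + x t * (x t * (x t * x t))) has_integral
      (((integral {0..1} (\<lambda>t. z t * (z t * (z t * z t))) + 4 * 0)
      + 6 * (integral {0..1} (\<lambda>t. z t * z t) * integral {0..1} (\<lambda>t. x t * x t)))
      + 4 * 0) + integral {0..1} (\<lambda>t. x t * (x t * (x t * x t)))) {0..1}"
      using cd[THEN integrable_integral] z3x z2x2 zx3 by (intro has_integral_add has_integral_mult_right) auto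
    then show ?thesis by (intro integral_unique) (simp add: power2_eq_square power4_eq_xxxx algebra_simps)
  qed
  have x4le: "integral {0..1} (\<lambda>t. (x t)^4) \<le> M^4"
  proof -
    have "integral {0..1} (\<lambda>t. (x t)^4) \<le> integral {0..1} (\<lambda>t::real. M^4)"
    proof (rule integral_le)
      show "(x t)^4 \<le> M^4" for t
        using power_mono[OF Suc.prems(4)[of n t], of 4] by (simp add: x_def power_abs)
    qed (use cd(5) in \<open>auto simp: power4_eq_xxxx mult.assoc\<close>)
    then show ?thesis by simp
  qed
  have tz: "tpoly {j. 3 * \<bar>j\<bar> < Q (Suc n)} (Z (Suc n))"
    unfolding Zx using Qn by (intro tpoly.add tpoly_mono[OF IH(1)] tpoly_mono[OF tx]) auto
  have m: "integral {0..1} (Z (Suc n)) = 0"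
    unfolding Zx using IH(2) x0 by (subst Henstock_Kurzweil_Integration.integral_add) (auto intro: tpoly_integrable[OF IH(1)] tpoly_integrable[OF tx])
  define v e where "v = integral {0..1} (\<lambda>t. (z t)\<^sup>2)" and "e = integral {0..1} (\<lambda>t. (x t)\<^sup>2)"
  have "integral {0..1} (\<lambda>t. (z t + x t)^4) \<le> 3 * v\<^sup>2 + real n * M^4 + 6 * (v * e) + M^4"
    using quart IH(4) x4le by (simp add: v_def e_def)
  \<comment> \<open>The mixed term \<open>6 v e\<close> is exactly the one in
    \<open>3 (v + e)^2\<close>, so the Gaussian constant 3 survives the induction.\<close>
  also have "\<dots> \<le> 3 * (v + e)\<^sup>2 + real (Suc n) * M^4"
    by (simp add: power2_eq_square algebra_simps)
  finally have "integral {0..1} (\<lambda>x. (Z (Suc n) x)^4) \<le> 3 * (integral {0..1} (\<lambda>x. (Z (Suc n) x)\<^sup>2))\<^sup>2 + real (Suc n) * M^4"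
    using sq by (simp add: Zx v_def e_def)
  moreover have "integral {0..1} (\<lambda>t. (Z (Suc n) t)\<^sup>2) = (\<Sum>r<Suc n. integral {0..1} (\<lambda>x. (X r x)\<^sup>2))"
    using sq IH(3) by (simp add: Zx x_def)
  ultimately show ?case using tz m by blast
qed

section \<open>Large values of sums over runs\<close>

lemma compact_superlevel:
  fixes Y :: "real \<Rightarrow> real"
  assumes "continuous_on {0..1} Y" shows "compact {y \<in> {0..1}. a \<le> Y y}"
proof -
  have "closed ({0..1} \<inter> Y -` {a..})" by (rule continuous_closed_preimage[OF assms]) auto
  moreover have "{0..1} \<inter> Y -` {a..} = {y \<in> {0..1}. a \<le> Y y}" by auto
  moreover have "bounded {y \<in> {0..1::real}. a \<le> Y y}" by (rule bounded_subset[of "{0..1}"]) auto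
  ultimately show ?thesis by (simp add: compact_eq_bounded_closed)
qed

text \<open>
  After normalising \<open>Y\<close> to second moment \<open>1\<close>, the quartic \<open>q\<close> in the proof has mean at least \<open>1/4\<close>;
  it is at most \<open>0\<close> to the left of \<open>1/6\<close> and at most \<open>5\<close> everywhere.
\<close>

lemma second_fourth_moment_tail:
  fixes Y :: "real \<Rightarrow> real"
  assumes c: "continuous_on {0..1} Y" and v: "0 < v" and m1: "integral {0..1} Y = 0"
    and m2: "integral {0..1} (\<lambda>x. (Y x)\<^sup>2) = v" and m4: "integral {0..1} (\<lambda>x. (Y x)^4) \<le> 4 * v\<^sup>2"
  shows "1 / 20 \<le> measure lebesgue {y \<in> {0..1}. sqrt v / 6 \<le> Y y}"
proof -
  \<comment> \<open>The linear term has mean zero and costs nothing; it pushes \<open>q\<close>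
    below 0 on the negative side, so that the resulting tail bound is one-sided.\<close>
  define q where "q u = 6/5 * u + u\<^sup>2 - u^4 / 8 - 1/4" for u :: real
  define S where "S = {y \<in> {0..1}. sqrt v / 6 \<le> Y y}"
  have "compact S"
    unfolding S_def by (rule compact_superlevel[OF c])
  then have S: "S \<in> lmeasurable" by (rule lmeasurable_compact)
  have q1: "q u \<le> 5" for u
  proof -
    have "5 - q u = (u\<^sup>2 - 5)\<^sup>2 / 8 + (u/2 - 6/5)\<^sup>2 + (17/8 - 36/25)"
      unfolding q_def by (simp add: power2_eq_square power4_eq_xxxx field_simps)
    also have "\<dots> \<ge> 0" by (intro add_nonneg_nonneg) auto
    finally show ?thesis by simp
  qed
  have q2: "q u \<le> 0" if "u < 1/6" for u
  proof (cases "u < 0")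
    case True
    define t where "t = - u"
    have t: "t > 0" using True t_def by simp
    \<comment> \<open>The cubic \<open>t^3 - 8 t + 48/5\<close> has its minimum at
      \<open>sqrt (8/3)\<close>; the rational double root \<open>5/3\<close> nearby gives a slightly
      smaller cubic in factored form.\<close>
    have "0 \<le> (3 * t - 5)\<^sup>2 * (3 * t + 10)" using t by simp
    also have "\<dots> = 27 * t^3 - 225 * t + 250"
      by (simp add: power2_eq_square power3_eq_cube algebra_simps)
    finally have "0 \<le> t^3 - 8 * t + 48/5" using t by linarith
    then have "0 \<le> (t^3 - 8 * t + 48/5) * t / 8" using t by simp
    also have "\<dots> = - q u - 1/4" by (simp add: q_def t_def power2_eq_square power3_eq_cube power4_eq_xxxx field_simps)
    finally show ?thesis by simp
  next
    case False
    then have "u\<^sup>2 \<le> 1/36" using power_mono[of u "1/6" 2] that by (simp add: power_divide)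
    moreover have "u^4 \<ge> 0" by simp
    ultimately show ?thesis using that unfolding q_def by linarith
  qed
  define w where "w = 1 / sqrt v"
  have w: "w > 0" "w\<^sup>2 = 1 / v" "w^4 = 1 / v\<^sup>2"
  proof -
    have "sqrt v ^ 4 = ((sqrt v)\<^sup>2)\<^sup>2" by (simp only: power_mult[symmetric]) simp
    then show "w > 0" "w\<^sup>2 = 1 / v" "w^4 = 1 / v\<^sup>2"
      using v by (simp_all add: w_def power_divide)
  qed
  note I = integrable_continuous_interval
  have i: "Y integrable_on {0..1}" "(\<lambda>x. (Y x)\<^sup>2) integrable_on {0..1}" "(\<lambda>x. (Y x)^4) integrable_on {0..1}"
    by (intro I continuous_intros c)+
  have "((\<lambda>x. ((6/5 * w) * Y x + w\<^sup>2 * (Y x)\<^sup>2) - (w^4 / 8) * (Y x)^4 - 1/4) has_integral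
      ((6/5 * w) * 0 + w\<^sup>2 * v) - (w^4/8) * integral {0..1} (\<lambda>x. (Y x)^4) - 1/4) {0..1}"
    using i[THEN integrable_integral] m1 m2 has_integral_const_real[of "1/4" 0 1]
    by (intro has_integral_diff has_integral_add has_integral_mult_right) auto
  moreover have "(\<lambda>x. ((6/5 * w) * Y x + w\<^sup>2 * (Y x)\<^sup>2) - (w^4 / 8) * (Y x)^4 - 1/4) = (\<lambda>x. q (w * Y x))"
    by (auto simp: q_def power_mult_distrib)
  ultimately have hi: "((\<lambda>x. q (w * Y x)) has_integral
      (w\<^sup>2 * v - (w^4/8) * integral {0..1} (\<lambda>x. (Y x)^4) - 1/4)) {0..1}"
    by simp
  have "(w^4/8) * integral {0..1} (\<lambda>x. (Y x)^4) \<le> (w^4/8) * (4 * v\<^sup>2)"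
    using m4 w(1) by (intro mult_left_mono) auto
  also have "\<dots> = 1/2" using v w by simp
  finally have "(w^4/8) * integral {0..1} (\<lambda>x. (Y x)^4) \<le> 1/2" .
  moreover have "w\<^sup>2 * v = 1" using v w by simp
  ultimately have l: "1/4 \<le> w\<^sup>2 * v - (w^4/8) * integral {0..1} (\<lambda>x. (Y x)^4) - 1/4"
    by linarith
  have "((\<lambda>x. 5 * indicat_real S x) has_integral 5 * measure lebesgue S) {0..1}"
  proof (rule has_integral_mult_right)
    have "(indicat_real S has_integral measure lebesgue S) UNIV" using lmeasurable_iff_has_integral S by blast
    then have "((\<lambda>x. if x \<in> {0..1} then indicat_real S x else 0) has_integral measure lebesgue S) UNIV"
      by (rule has_integral_eq[rotated]) (auto simp: S_def indicator_def)
    then show "(indicat_real S has_integral measure lebesgue S) {0..1}"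
      by (simp only: has_integral_restrict_UNIV)
  qed
  then have "w\<^sup>2 * v - (w^4/8) * integral {0..1} (\<lambda>x. (Y x)^4) - 1/4 \<le> 5 * measure lebesgue S"
  proof (rule has_integral_le[OF hi])
    fix x :: real assume x: "x \<in> {0..1}"
    show "q (w * Y x) \<le> 5 * indicat_real S x"
    proof (cases "x \<in> S")
      case False
      then have "Y x < sqrt v / 6" using x by (auto simp: S_def)
      then have "w * Y x < w * (sqrt v / 6)" using w by simp
      also have "\<dots> = 1/6" using v by (simp add: w_def)
      finally show ?thesis using q2 False by simp
    qed (use q1 in simp)
  qed
  then have "1 / 20 \<le> measure lebesgue S" using l by linarith
  then show ?thesis unfolding S_def .
qed

text \<open>This is the sum of \<open>f\<close> over a run whose offset has been frozen. The phase
  depends on \<open>j\<close> alone, because an offset \<open>c\<close> adds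
  \<open>2 pi 2^j c x\<close> at every position of the run.\<close>

definition run_sum :: "nat \<Rightarrow> nat \<Rightarrow> (nat \<Rightarrow> real) \<Rightarrow> real \<Rightarrow> real" where
  "run_sum d e \<theta> y = (\<Sum>i\<in>{..<2*d}\<times>{..<d}. cos (2 * pi * of_int (2 ^ (e + fst i + snd i)) * y + \<theta> (snd i)))"

lemma tpoly_run_sum:
  assumes "d \<ge> 1" "e + 3 * d + 2 \<le> e'"
  shows "tpoly {j. 2 ^ e dvd j \<and> j \<noteq> 0 \<and> 3 * \<bar>j\<bar> < 2 ^ e'} (run_sum d e \<theta>)"
  unfolding run_sum_def[abs_def]
proof (intro tpoly_sum tpoly.cos CollectI conjI)
  fix i assume i: "i \<in> {..<2 * d} \<times> {..<d}"
  show "2 ^ e dvd (2 :: int) ^ (e + fst i + snd i)" by (intro le_imp_power_dvd) simp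
  have "(2::int) ^ (e + fst i + snd i) \<le> 2 ^ (e + 3 * d)" using i by (intro power_increasing) auto
  moreover have "(0::int) < 2 ^ (e + 3 * d)" by simp
  moreover have "(2::int) ^ (e + 3 * d + 2) \<le> 2 ^ e'" using assms by (intro power_increasing) auto
  moreover have "(2::int) ^ (e + 3 * d + 2) = 4 * 2 ^ (e + 3 * d)" by (simp add: power_add)
  ultimately have "3 * 2 ^ (e + fst i + snd i) < (2 :: int) ^ e'" by linarith
  then show "3 * \<bar>2 ^ (e + fst i + snd i)\<bar> < (2 :: int) ^ e'" by simp
qed auto

lemma integral_cos_mult_cos:
  fixes a b :: int
  assumes "a > 0" "b > 0"
  shows "((\<lambda>y. cos (2 * pi * of_int a * y + s) * cos (2 * pi * of_int b * y + t)) has_integral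
     (if a = b then cos (s - t) / 2 else 0)) {0..1}"
proof -
  have "cos (2 * pi * of_int a * x + s) * cos (2 * pi * of_int b * x + t)
      = (1/2) * (cos (2 * pi * of_int (a - b) * x + (s - t)) + cos (2 * pi * of_int (a + b) * x + (s + t)))" for x
      unfolding cos_times_cos by (simp add: algebra_simps)
  then have "(\<lambda>x. cos (2 * pi * of_int a * x + s) * cos (2 * pi * of_int b * x + t))
      = (\<lambda>x. (1/2) * (cos (2 * pi * of_int (a - b) * x + (s - t)) + cos (2 * pi * of_int (a + b) * x + (s + t))))"
    by blast
  moreover have "((\<lambda>x. (1/2) * (cos (2 * pi * of_int (a - b) * x + (s - t)) + cos (2 * pi * of_int (a + b) * x + (s + t))))
    has_integral (1/2) * ((if a - b = 0 then cos (s - t) else 0) + (if a + b = 0 then cos (s + t) else 0))) {0..1}"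
    by (intro has_integral_mult_right has_integral_add has_integral_cos_period)
  moreover have "(1/2) * ((if a - b = 0 then cos (s - t) else 0) + (if a + b = 0 then cos (s + t) else 0))
    = (if a = b then cos (s - t) / 2 else 0)"
    using assms by simp
  ultimately show ?thesis by (simp only:)
qed

text \<open>
  The coincidences \<open>s + j = s' + j'\<close> between frequencies produce \<open>d^3\<close> instead of the \<open>2 d\<^sup>2\<close> diagonal
  terms; this is the gain of a factor of order \<open>d\<close> in the variance.
\<close>

lemma run_sum_second_moment:
  assumes th: "\<And>j. j < d \<Longrightarrow> \<bar>\<theta> j\<bar> \<le> pi / 6"
  shows "real d ^ 3 / 4 \<le> integral {0..1} (\<lambda>y. (run_sum d e \<theta> y)\<^sup>2)"
proof -
  define I where "I = {..<2*d}\<times>{..<d}"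
  define J where "J = {(i, i'). i \<in> I \<and> i' \<in> I \<and> fst i + snd i = fst i' + snd i'}"
  have fI: "finite I" by (auto simp: I_def)
  have JI: "J \<subseteq> I \<times> I" by (auto simp: J_def)
  then have fJ: "finite J" using fI by (meson finite_SigmaI finite_subset)
  define h where "h i i' = (if fst i + snd i = fst i' + snd i' then cos (\<theta> (snd i) - \<theta> (snd i')) / 2 else 0)" for i i' :: "nat \<times> nat"
  have "((\<lambda>y. \<Sum>i\<in>I. \<Sum>i'\<in>I. cos (2 * pi * of_int (2 ^ (e + fst i + snd i)) * y + \<theta> (snd i))
        * cos (2 * pi * of_int (2 ^ (e + fst i' + snd i')) * y + \<theta> (snd i'))) has_integral
      (\<Sum>i\<in>I. \<Sum>i'\<in>I. (if (2::int) ^ (e + fst i + snd i) = 2 ^ (e + fst i' + snd i') then cos (\<theta> (snd i) - \<theta> (snd i')) / 2 else 0))) {0..1}"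
    by (intro has_integral_sum fI integral_cos_mult_cos) auto
  then have "((\<lambda>y. (run_sum d e \<theta> y)\<^sup>2) has_integral (\<Sum>i\<in>I. \<Sum>i'\<in>I. h i i')) {0..1}"
    unfolding run_sum_def power2_eq_square sum_product I_def[symmetric] h_def by (simp add: add.assoc)
  then have eq: "integral {0..1} (\<lambda>y. (run_sum d e \<theta> y)\<^sup>2) = (\<Sum>i\<in>I. \<Sum>i'\<in>I. h i i')"
    by (rule integral_unique)
  \<comment> \<open>Both pairs have exponent \<open>t + j + j'\<close>. Runs have length
    \<open>2 d\<close> so that \<open>t + j'\<close> is always a valid position.\<close>
  have inj: "inj_on (\<lambda>(j, j', t). ((t + j', j), (t + j, j'))) ({..<d} \<times> {..<d} \<times> {..<d})"
    by (auto simp: inj_on_def)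
  have "(\<lambda>(j, j', t). ((t + j', j), (t + j, j'))) ` ({..<d} \<times> {..<d} \<times> {..<d}) \<subseteq> J"
    by (auto simp: J_def I_def)
  from card_mono[OF fJ this] have "d ^ 3 \<le> card J"
    by (simp add: card_image[OF inj] power3_eq_cube card_cartesian_product)
  then have "real d ^ 3 / 4 \<le> (\<Sum>(i,i')\<in>J. 1/4)"
    by (simp add: case_prod_unfold flip: of_nat_power)
  also have "\<dots> \<le> (\<Sum>(i,i')\<in>J. h i i')"
  proof (rule sum_mono, clarify)
    fix a b a' b' assume "((a, b), (a', b')) \<in> J"
    then have *: "b < d" "b' < d" "a + b = a' + b'" by (auto simp: J_def I_def)
    \<comment> \<open>Two phases within \<open>pi / 6\<close> of 0 differ by at most
      \<open>pi / 3\<close>, so every coincidence contributes positively.\<close>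
    have "\<bar>\<theta> b - \<theta> b'\<bar> \<le> pi / 3" using th[OF *(1)] th[OF *(2)] by linarith
    then have "cos (pi / 3) \<le> cos \<bar>\<theta> b - \<theta> b'\<bar>" by (intro cos_monotone_0_pi_le) auto
    then have "1 / 2 \<le> cos (\<theta> b - \<theta> b')" by (simp add: cos_60)
    then show "1 / 4 \<le> h (a, b) (a', b')" using * by (simp add: h_def)
  qed
  also have "\<dots> = (\<Sum>(i,i')\<in>I\<times>I. h i i')"
    by (rule sum.mono_neutral_left) (use fI JI in \<open>auto simp: J_def h_def split: if_splits\<close>)
  finally show ?thesis unfolding eq sum.cartesian_product .
qed

lemma abs_run_sum_le: "\<bar>run_sum d e \<theta> y\<bar> \<le> 2 * real d ^ 2"
proof -
  have "\<bar>run_sum d e \<theta> y\<bar> \<le> (\<Sum>i\<in>{..<2*d}\<times>{..<d}. 1)"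
    unfolding run_sum_def by (rule order_trans[OF sum_abs]) (intro sum_mono abs_cos_le_one)
  then show ?thesis by (simp add: power2_eq_square card_cartesian_product)
qed

text \<open>The variance \<open>v\<close> is at least \<open>B d^3 / 4\<close>, and
  \<open>B \<ge> 256 d^2\<close> makes the error \<open>16 B d^8\<close> in the fourth moment at
  most \<open>v^2\<close>; this gives the bound \<open>4 v^2\<close> needed for the tail
  estimate.\<close>

lemma group_sum_tail:
  assumes d: "d \<ge> 1" and B: "B \<ge> 256 * d\<^sup>2" and e: "\<And>r. Suc r < B \<Longrightarrow> e r + 3 * d + 2 \<le> e (Suc r)"
    and th: "\<And>r j. r < B \<Longrightarrow> j < d \<Longrightarrow> \<bar>\<theta> r j\<bar> \<le> pi / 6"
  shows "1 / 20 \<le> measure lebesgue {y \<in> {0..1}. sqrt (real B * real d ^ 3) / 12 \<le> (\<Sum>r<B. run_sum d (e r) (\<theta> r) y)}"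
proof -
  \<comment> \<open>Nothing is known about \<open>e B\<close>; the redefinition supplies a frequency
    bound above the last run.\<close>
  define e' where "e' r = (if r < B then e r else e (B - 1) + 3 * d + 2)" for r
  define X where "X r = run_sum d (e r) (\<theta> r)" for r
  define Z where "Z y = (\<Sum>r<B. X r y)" for y
  have e': "e r + 3 * d + 2 \<le> e' (Suc r)" if "r < B" for r
  proof (cases "Suc r < B")
    case True then show ?thesis using e[of r] by (simp add: e'_def)
  next
    case False then have "B - 1 = r" using that by auto
    then show ?thesis using False by (simp add: e'_def)
  qed
  have B0: "B > 0" using B d by (cases "B = 0") auto
  have X: "tpoly {j. 2 ^ e' r dvd j \<and> j \<noteq> 0 \<and> 3 * \<bar>j\<bar> < 2 ^ e' (Suc r)} (X r)" if "r < B" for r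
    using tpoly_run_sum[OF d e'[OF that]] that by (simp add: X_def e'_def)
  have M: "tpoly {j. 3 * \<bar>j\<bar> < 2 ^ e' B} (\<lambda>y. \<Sum>r<B. X r y) \<and> integral {0..1} (\<lambda>y. \<Sum>r<B. X r y) = 0
    \<and> integral {0..1} (\<lambda>x. (\<Sum>r<B. X r x)\<^sup>2) = (\<Sum>r<B. integral {0..1} (\<lambda>x. (X r x)\<^sup>2))
    \<and> integral {0..1} (\<lambda>x. (\<Sum>r<B. X r x)^4) \<le> 3 * (integral {0..1} (\<lambda>x. (\<Sum>r<B. X r x)\<^sup>2))\<^sup>2 + real B * (2 * real d ^ 2)^4"
  proof (rule tpoly_sum_moments)
    fix r assume r: "r < B"
    show "tpoly {j. 2 ^ e' r dvd j \<and> 3 * \<bar>j\<bar> < 2 ^ e' (Suc r)} (X r)" using X[OF r] by (rule tpoly_mono) auto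
    show "integral {0..1} (X r) = 0" using X[OF r] by (rule tpoly_integral_0) auto
    have "e' r \<le> e' (Suc r)" using e'[OF r] r by (simp add: e'_def)
    then show "0 < (2::int) ^ e' r \<and> (2::int) ^ e' r \<le> 2 ^ e' (Suc r)" by simp
    show "\<bar>X r x\<bar> \<le> 2 * real d ^ 2" for x by (simp add: X_def abs_run_sum_le)
  qed
  define v where "v = integral {0..1} (\<lambda>x. (Z x)\<^sup>2)"
  have Z: "Z = (\<lambda>y. \<Sum>r<B. X r y)" by (auto simp: Z_def)
  have M1: "tpoly {j. 3 * \<bar>j\<bar> < 2 ^ e' B} Z" and M2: "integral {0..1} Z = 0"
    and M3: "v = (\<Sum>r<B. integral {0..1} (\<lambda>x. (X r x)\<^sup>2))"
    and M4: "integral {0..1} (\<lambda>x. (Z x)^4) \<le> 3 * v\<^sup>2 + real B * (2 * real d ^ 2)^4"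
    unfolding v_def Z
    subgoal using M by (rule conjunct1)
    subgoal using M by (rule conjunct1[OF conjunct2])
    subgoal using M by (rule conjunct1[OF conjunct2[OF conjunct2]])
    subgoal using M by (rule conjunct2[OF conjunct2[OF conjunct2]])
    done
  have cZ: "continuous_on {0..1} Z" using M1 by (rule tpoly_continuous)
  have v: "v \<ge> real B * (real d ^ 3 / 4)"
  proof -
    have "real B * (real d ^ 3 / 4) = (\<Sum>r<B. real d ^ 3 / 4)" by simp
    also have "\<dots> \<le> (\<Sum>r<B. integral {0..1} (\<lambda>x. (X r x)\<^sup>2))"
      unfolding X_def using th by (intro sum_mono run_sum_second_moment) auto
    finally show ?thesis by (simp add: M3)
  qed
  have pos: "real B * (real d ^ 3 / 4) > 0" using B0 d by simp
  have "real B * (2 * real d ^ 2)^4 = real B * real d ^ 6 * (256 * real d ^ 2) / 16"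
    by (simp add: eval_nat_numeral)
  also have "\<dots> \<le> real B * real d ^ 6 * real B / 16"
  proof -
    have "real (256 * d\<^sup>2) \<le> real B" using B by (simp only: of_nat_le_iff)
    then show ?thesis by (intro divide_right_mono mult_left_mono) auto
  qed
  also have "\<dots> = (real B * (real d ^ 3 / 4))\<^sup>2"
    by (simp add: eval_nat_numeral)
  also have "\<dots> \<le> v\<^sup>2" using v pos by (intro power_mono) auto
  finally have q: "integral {0..1} (\<lambda>x. (Z x)^4) \<le> 4 * v\<^sup>2"
    using M4 by linarith
  have "1 / 20 \<le> measure lebesgue {y \<in> {0..1}. sqrt v / 6 \<le> Z y}"
    using v pos by (intro second_fourth_moment_tail cZ M2 q) (auto simp: v_def)
  also have "\<dots> \<le> measure lebesgue {y \<in> {0..1}. sqrt (real B * real d ^ 3) / 12 \<le> Z y}"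
  proof (rule measure_mono_fmeasurable)
    have "sqrt (real B * real d ^ 3) / 12 = sqrt (real B * (real d ^ 3 / 4)) / 6"
      by (simp add: real_sqrt_mult real_sqrt_divide)
    also have "\<dots> \<le> sqrt v / 6" using v by simp
    finally show "{y \<in> {0..1}. sqrt v / 6 \<le> Z y} \<subseteq> {y \<in> {0..1}. sqrt (real B * real d ^ 3) / 12 \<le> Z y}" by auto
    show "{y \<in> {0..1}. sqrt v / 6 \<le> Z y} \<in> sets lebesgue"
      by (intro fmeasurableD lmeasurable_compact compact_superlevel cZ)
    show "{y \<in> {0..1}. sqrt (real B * real d ^ 3) / 12 \<le> Z y} \<in> lmeasurable"
      by (intro lmeasurable_compact compact_superlevel cZ)
  qed
  finally show ?thesis by (simp add: Z_def X_def)
qed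

section \<open>Dyadic sets and a Borel--Cantelli lemma\<close>

definition cell :: "nat \<Rightarrow> int \<Rightarrow> real set" where
  "cell t k = {of_int k / 2 ^ t ..< (of_int k + 1) / 2 ^ t}"

text \<open>These are the events decided by the first \<open>t\<close> binary digits, i.e. the
  dyadic filtration, written with a set of digit prefixes.\<close>

definition dyadic :: "nat \<Rightarrow> real set \<Rightarrow> bool" where
  "dyadic t U \<longleftrightarrow> (\<exists>S::int set. U = {x \<in> {0..<1}. \<lfloor>2 ^ t * x\<rfloor> \<in> S})"

lemma mem_cell_iff: "x \<in> cell t k \<longleftrightarrow> \<lfloor>2 ^ t * x\<rfloor> = k"
  unfolding cell_def by (auto simp: floor_eq_iff field_simps)

lemma half_open_lmeasurable: "{a..<b::real} \<in> lmeasurable"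
  by (rule bounded_set_imp_lmeasurable) (auto intro: sets_completionI_sets)

lemma measure_cell: "measure lebesgue (cell t k) = 1 / 2 ^ t" and cell_lmeasurable: "cell t k \<in> lmeasurable"
  unfolding cell_def by (simp add: field_simps) (rule half_open_lmeasurable)

lemma mem_unit_iff_floor: "x \<in> {0..<1} \<longleftrightarrow> \<lfloor>2 ^ t * x\<rfloor> \<in> {0..<2 ^ t}" for x :: real
proof -
  have "0 \<le> 2 ^ t * x \<longleftrightarrow> 0 \<le> x" using mult_le_cancel_left_pos[of "2 ^ t" 0 x] by simp
  then show ?thesis by (simp add: floor_less_iff)
qed

lemma floor_refine:
  assumes "t \<le> t'" shows "\<lfloor>2 ^ t * x\<rfloor> = \<lfloor>2 ^ t' * x :: real\<rfloor> div 2 ^ (t' - t)"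
proof -
  have "(2::real) ^ t * x = 2 ^ t' * x / of_int (2 ^ (t' - t))"
    using assms by (simp add: field_simps flip: power_add)
  then show ?thesis using floor_divide_real_eq_div[of "2 ^ (t' - t)" "2 ^ t' * x"] by simp
qed

lemma dyadic_mono: assumes "dyadic t U" "t \<le> t'" shows "dyadic t' U"
proof -
  obtain S where "U = {x \<in> {0..<1}. \<lfloor>2 ^ t * x\<rfloor> \<in> S}" using assms unfolding dyadic_def by blast
  then have "U = {x \<in> {0..<1}. \<lfloor>2 ^ t' * x\<rfloor> \<in> {k. k div 2 ^ (t' - t) \<in> S}}"
    using floor_refine[OF assms(2)] by simp
  then show ?thesis unfolding dyadic_def by blast
qed

lemma dyadic_Int: assumes "dyadic t U" "dyadic t V" shows "dyadic t (U \<inter> V)"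
proof -
  obtain S T where "U = {x \<in> {0..<1}. \<lfloor>2 ^ t * x\<rfloor> \<in> S}" "V = {x \<in> {0..<1}. \<lfloor>2 ^ t * x\<rfloor> \<in> T}"
    using assms unfolding dyadic_def by blast
  then have "U \<inter> V = {x \<in> {0..<1}. \<lfloor>2 ^ t * x\<rfloor> \<in> S \<inter> T}" by auto
  then show ?thesis unfolding dyadic_def by blast
qed

lemma dyadic_Diff: assumes "dyadic t U" "dyadic t V" shows "dyadic t (U - V)"
proof -
  obtain S T where "U = {x \<in> {0..<1}. \<lfloor>2 ^ t * x\<rfloor> \<in> S}" "V = {x \<in> {0..<1}. \<lfloor>2 ^ t * x\<rfloor> \<in> T}"
    using assms unfolding dyadic_def by blast
  then have "U - V = {x \<in> {0..<1}. \<lfloor>2 ^ t * x\<rfloor> \<in> S - T}" by auto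
  then show ?thesis unfolding dyadic_def by blast
qed

lemma dyadic_unit: "dyadic t {0..<1}"
proof -
  have "{0..<1} = {x \<in> {0..<1::real}. \<lfloor>2 ^ t * x\<rfloor> \<in> UNIV}" by blast
  then show ?thesis unfolding dyadic_def by blast
qed

lemma dyadic_eq_UN:
  assumes "dyadic t U"
  shows "\<exists>S \<subseteq> {0..<2 ^ t}. U = (\<Union>k\<in>S. cell t k)"
proof -
  obtain S where S: "U = {x \<in> {0..<1}. \<lfloor>2 ^ t * x\<rfloor> \<in> S}" using assms unfolding dyadic_def by blast
  have "U = (\<Union>k\<in>S \<inter> {0..<2 ^ t}. cell t k)"
  proof (rule set_eqI)
    fix x show "x \<in> U \<longleftrightarrow> x \<in> (\<Union>k\<in>S \<inter> {0..<2 ^ t}. cell t k)"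
      unfolding S UN_iff mem_cell_iff mem_Collect_eq mem_unit_iff_floor[of x t] by blast
  qed
  then show ?thesis by blast
qed

lemma dyadic_lmeasurable: "dyadic t U \<Longrightarrow> U \<in> lmeasurable"
proof -
  assume "dyadic t U"
  then obtain S where S: "S \<subseteq> {0..<2 ^ t}" "U = (\<Union>k\<in>S. cell t k)" using dyadic_eq_UN by blast
  have "finite S" using S(1) by (rule finite_subset) simp
  then show ?thesis unfolding S(2) using cell_lmeasurable by (intro fmeasurable.finite_UN) auto
qed

lemma dyadic_subset_unit: "dyadic t U \<Longrightarrow> U \<subseteq> {0..<1}"
  unfolding dyadic_def by auto

lemma dyadic_measure_le_1: "dyadic t U \<Longrightarrow> measure lebesgue U \<le> 1"
  using measure_mono_fmeasurable[OF dyadic_subset_unit fmeasurableD[OF dyadic_lmeasurable] half_open_lmeasurable, of t U t]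
  by simp

text \<open>The conditional bounds are summed over disjoint cells. Only cells inside
  \<open>U\<close> are asked for, so the bound on a cell may use whatever \<open>U\<close> already
  guarantees there.\<close>

lemma dyadic_measure_Int_ge:
  assumes U: "dyadic t U" and A: "A \<in> sets lebesgue"
    and q: "\<And>k. 0 \<le> k \<Longrightarrow> k < 2 ^ t \<Longrightarrow> cell t k \<subseteq> U \<Longrightarrow> q / 2 ^ t \<le> measure lebesgue (cell t k \<inter> A)"
  shows "q * measure lebesgue U \<le> measure lebesgue (U \<inter> A)"
proof -
  obtain S where S: "S \<subseteq> {0..<2 ^ t}" "U = (\<Union>k\<in>S. cell t k)" using dyadic_eq_UN[OF U] by blast
  have fS: "finite S" using S(1) by (rule finite_subset) simp
  have cA: "cell t k \<inter> A \<in> lmeasurable" for k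
    using cell_lmeasurable A by (metis fmeasurable_Int_fmeasurable)
  have m: "measure lebesgue (\<Union>k\<in>S. D k) = (\<Sum>k\<in>S. measure lebesgue (D k))"
    if "\<And>k. D k \<in> lmeasurable" "\<And>k. D k \<subseteq> cell t k" for D
  proof (rule measure_finite_Union[OF fS])
    show "D ` S \<subseteq> sets lebesgue" using that(1) fmeasurableD by blast
    show "disjoint_family_on D S"
      using that(2) unfolding disjoint_family_on_def by (metis disjoint_iff mem_cell_iff subsetD)
    show "emeasure lebesgue (D k) \<noteq> \<infinity>" for k using fmeasurableD2[OF that(1)] unfolding infinity_ennreal_def .
  qed
  have m1: "measure lebesgue U = (\<Sum>k\<in>S. measure lebesgue (cell t k))"
    unfolding S(2) by (rule m) (use cell_lmeasurable in auto)
  have "U \<inter> A = (\<Union>k\<in>S. cell t k \<inter> A)" using S(2) by auto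
  then have m2: "measure lebesgue (U \<inter> A) = (\<Sum>k\<in>S. measure lebesgue (cell t k \<inter> A))"
    using m[of "\<lambda>k. cell t k \<inter> A"] cA by simp
  have "q * measure lebesgue U = (\<Sum>k\<in>S. q / 2 ^ t)" by (simp add: m1 measure_cell)
  also have "\<dots> \<le> (\<Sum>k\<in>S. measure lebesgue (cell t k \<inter> A))"
    using S by (intro sum_mono q) auto
  finally show ?thesis unfolding m2 .
qed

text \<open>A second Borel--Cantelli lemma with conditional bounds in place of independence:
  avoiding one more event multiplies the measure by at most
  \<open>1 - q m \<le> exp (- q m)\<close>, and the product tends to 0.\<close>

lemma dyadic_borel_cantelli:
  fixes q :: "nat \<Rightarrow> real"
  assumes tau: "\<And>m. \<tau> m \<le> \<tau> (Suc m)"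
    and A: "\<And>m. dyadic (\<tau> (Suc m)) (A m)"
    and q: "\<And>m U. dyadic (\<tau> m) U \<Longrightarrow> q m * measure lebesgue U \<le> measure lebesgue (U \<inter> A m)"
    and q0: "\<And>m. 0 \<le> q m" and div: "\<not> summable q"
  shows "negligible {x \<in> {0..<1}. finite {m. x \<in> A m}}"
proof -
  define C where "C M n = {x \<in> {0..<1}. \<forall>i\<in>{M..<M + n}. x \<notin> A i}" for M n
  have C_Suc: "C M (Suc n) = C M n - A (M + n)" for M n
    by (auto simp: C_def less_Suc_eq)
  have C: "dyadic (\<tau> (M + n)) (C M n) \<and> measure lebesgue (C M n) \<le> exp (- (\<Sum>i<n. q (M + i)))" for M n
  proof (induction n)
    case 0
    have "C M 0 = {0..<1}" by (auto simp: C_def)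
    then show ?case using dyadic_unit dyadic_measure_le_1[OF dyadic_unit] by simp
  next
    case (Suc n)
    have d: "dyadic (\<tau> (Suc (M + n))) (C M n)" using Suc tau dyadic_mono by blast
    have "measure lebesgue (C M (Suc n)) = measure lebesgue (C M n - (C M n \<inter> A (M + n)))"
      unfolding C_Suc by (rule arg_cong[where f = "measure lebesgue"]) auto
    also have "\<dots> = measure lebesgue (C M n) - measure lebesgue (C M n \<inter> A (M + n))"
      using dyadic_lmeasurable[OF d] dyadic_lmeasurable[OF dyadic_Int[OF d A]]
      by (intro measurable_measure_Diff) (auto dest: fmeasurableD)
    also have "\<dots> \<le> measure lebesgue (C M n) * (1 - q (M + n))"
      using q[of "M + n" "C M n"] Suc by (simp add: algebra_simps)
    also have "\<dots> \<le> measure lebesgue (C M n) * exp (- q (M + n))"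
      using exp_ge_add_one_self[of "- q (M + n)"] by (intro mult_left_mono) auto
    also have "\<dots> \<le> exp (- (\<Sum>i<n. q (M + i))) * exp (- q (M + n))"
      using Suc by (intro mult_right_mono) auto
    also have "\<dots> = exp (- (\<Sum>i<Suc n. q (M + i)))" by (simp flip: exp_add)
    finally show ?case using dyadic_Diff[OF d A] C_Suc by simp
  qed
  have neg: "negligible (\<Inter>n. C M n)" for M
    unfolding negligible_outer
  proof (intro allI impI)
    fix e :: real assume "e > 0"
    have "\<not> summable (\<lambda>i. q (M + i))" using div summable_iff_shift[of q M] by (simp add: add.commute)
    then have "\<exists>n. (\<Sum>i<n. q (M + i)) > - ln e"
      using summableI_nonneg_bounded[of "\<lambda>i. q (M + i)" "- ln e"] q0 by (meson not_le)
    then obtain n where n: "(\<Sum>i<n. q (M + i)) > - ln e" by blast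
    have "measure lebesgue (C M n) \<le> exp (- (\<Sum>i<n. q (M + i)))" using C by blast
    also have "\<dots> < exp (ln e)" using n by simp
    finally have "measure lebesgue (C M n) < e" using \<open>e > 0\<close> by simp
    moreover have "C M n \<in> lmeasurable" using C dyadic_lmeasurable by blast
    ultimately show "\<exists>T. (\<Inter>n. C M n) \<subseteq> T \<and> T \<in> lmeasurable \<and> measure lebesgue T < e" by blast
  qed
  have "{x \<in> {0..<1}. finite {m. x \<in> A m}} \<subseteq> (\<Union>M. \<Inter>n. C M n)"
  proof
    fix x assume x: "x \<in> {x \<in> {0..<1}. finite {m. x \<in> A m}}"
    then obtain M where "\<And>m. x \<in> A m \<Longrightarrow> m < M" using finite_nat_bounded[of "{m. x \<in> A m}"] by auto
    then have "x \<in> (\<Inter>n. C M n)" using x by (auto simp: C_def) (meson leD)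
    then show "x \<in> (\<Union>M. \<Inter>n. C M n)" by blast
  qed
  moreover have "negligible (\<Union>M. \<Inter>n. C M n)"
    by (intro negligible_countable_Union) (use neg in auto)
  ultimately show ?thesis by (rule negligible_subset[rotated])
qed

text \<open>The \<open>h\<close> binary digits after the first \<open>t\<close> vanish, i.e.
  \<open>frac (2 ^ t * x) < 1 / 2 ^ h\<close>; the floor makes it visibly dyadic.\<close>

definition zero_bits :: "nat \<Rightarrow> nat \<Rightarrow> real set" where
  "zero_bits t h = {x \<in> {0..<1}. \<lfloor>2 ^ (t + h) * x\<rfloor> mod 2 ^ h = 0}"

lemma dyadic_zero_bits: "dyadic (t + h) (zero_bits t h)"
  unfolding dyadic_def zero_bits_def by (rule exI[of _ "{k. k mod 2 ^ h = 0}"]) auto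

lemma zero_bits_frac: 
  assumes "x \<in> zero_bits t h" shows "frac (2 ^ t * x) < 1 / 2 ^ h"
proof -
  define k where "k = \<lfloor>2 ^ (t + h) * x\<rfloor>"
  have "k mod 2 ^ h = 0" using assms by (simp add: zero_bits_def k_def)
  moreover have "\<lfloor>2 ^ t * x\<rfloor> = k div 2 ^ h" using floor_refine[of t "t + h" x] by (simp add: k_def)
  ultimately have k: "k = \<lfloor>2 ^ t * x\<rfloor> * 2 ^ h" by auto
  have "2 ^ (t + h) * x < k + 1" unfolding k_def by linarith
  then have "2 ^ h * (2 ^ t * x - \<lfloor>2 ^ t * x\<rfloor>) < 1" unfolding k by (simp add: power_add algebra_simps)
  then show ?thesis by (simp add: frac_def field_simps)
qed

text \<open>\<open>U\<close> depends on earlier digits only, and each of its cells contains a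
  subcell of level \<open>t + h\<close> with the required zeros.\<close>

lemma measure_zero_bits:
  assumes "dyadic t U"
  shows "(1 / 2 ^ h) * measure lebesgue U \<le> measure lebesgue (U \<inter> zero_bits t h)"
proof (rule dyadic_measure_Int_ge[OF assms])
  show "zero_bits t h \<in> sets lebesgue" using dyadic_lmeasurable[OF dyadic_zero_bits] by (rule fmeasurableD)
  fix k :: int assume k: "0 \<le> k" "k < 2 ^ t"
  have "cell (t + h) (k * 2 ^ h) \<subseteq> cell t k \<inter> zero_bits t h"
  proof
    fix x assume "x \<in> cell (t + h) (k * 2 ^ h)"
    then have x: "\<lfloor>2 ^ (t + h) * x\<rfloor> = k * 2 ^ h" by (simp add: mem_cell_iff)
    then have x': "\<lfloor>2 ^ t * x\<rfloor> = k" using floor_refine[of t "t + h" x] by simp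
    then have "x \<in> {0..<1}" using k mem_unit_iff_floor[of x t] by simp
    then show "x \<in> cell t k \<inter> zero_bits t h" using x x' by (simp add: mem_cell_iff zero_bits_def)
  qed
  then have "measure lebesgue (cell (t + h) (k * 2 ^ h)) \<le> measure lebesgue (cell t k \<inter> zero_bits t h)"
    using cell_lmeasurable dyadic_lmeasurable[OF dyadic_zero_bits]
    by (intro measure_mono_fmeasurable fmeasurable.Int) (auto dest: fmeasurableD)
  then show "1 / 2 ^ h / 2 ^ t \<le> measure lebesgue (cell t k \<inter> zero_bits t h)"
    by (simp add: measure_cell power_add mult.commute)
qed

text \<open>The superlevel set is enlarged to whole cells so that finitely many digits decide it.
  For \<open>F\<close> with Lipschitz constant at most \<open>2 ^ t\<close> this costs only 1 in the
  level.\<close>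

definition dyadic_superlevel :: "nat \<Rightarrow> (real \<Rightarrow> real) \<Rightarrow> real \<Rightarrow> real set" where
  "dyadic_superlevel t F a = {x \<in> {0..<1}. \<exists>y\<in>{0..<1}. \<lfloor>2 ^ t * y\<rfloor> = \<lfloor>2 ^ t * x\<rfloor> \<and> a \<le> F y}"

lemma dyadic_dyadic_superlevel: "dyadic t (dyadic_superlevel t F a)"
  unfolding dyadic_def dyadic_superlevel_def
  by (rule exI[of _ "{k. \<exists>y\<in>{0..<1}. \<lfloor>2 ^ t * y\<rfloor> = k \<and> a \<le> F y}"]) auto

lemma dyadic_superlevel_lower:
  assumes "x \<in> dyadic_superlevel t F a" and L: "\<And>x y. \<bar>F x - F y\<bar> \<le> L * \<bar>x - y\<bar>" and "0 \<le> L" "L \<le> 2 ^ t"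
  shows "a - 1 \<le> F x"
proof -
  obtain y where y: "\<lfloor>2 ^ t * y\<rfloor> = \<lfloor>2 ^ t * x\<rfloor>" "a \<le> F y" using assms(1) by (auto simp: dyadic_superlevel_def)
  have "\<bar>2 ^ t * y - 2 ^ t * x\<bar> \<le> 1" using y(1) by linarith
  then have "2 ^ t * \<bar>y - x\<bar> \<le> 1" by (simp add: abs_mult flip: right_diff_distrib)
  moreover have "L * \<bar>y - x\<bar> \<le> 2 ^ t * \<bar>y - x\<bar>" using assms by (intro mult_right_mono) auto
  ultimately have "\<bar>F y - F x\<bar> \<le> 1" using L[of y x] by linarith
  then show ?thesis using y(2) by linarith
qed

text \<open>The map \<open>2 ^ p * x - k\<close> takes the cell onto the unit interval, so by
  periodicity \<open>Z (2 ^ p * x)\<close> has on the cell the distribution that \<open>Z\<close>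
  has on \<open>{0..1}\<close>.\<close>

lemma measure_cell_superlevel_ge:
  fixes Z F :: "real \<Rightarrow> real"
  assumes per: "\<And>y (k::int). Z (y + of_int k) = Z y" and k: "0 \<le> k" "k < 2 ^ p"
    and c: "continuous_on {0..1} Z"
    and F: "\<And>x. x \<in> cell p k \<Longrightarrow> Z (2 ^ p * x) - 1 \<le> F x"
    and q: "q \<le> measure lebesgue {y \<in> {0..1}. b \<le> Z y}"
  shows "q / 2 ^ p \<le> measure lebesgue (cell p k \<inter> dyadic_superlevel t F (b - 1))"
proof -
  define S where "S = {y \<in> {0..1}. b \<le> Z y}"
  have S: "S \<in> lmeasurable" unfolding S_def by (intro lmeasurable_compact compact_superlevel c)
  define h where "h y = (1 / 2 ^ p) *\<^sub>R y + of_int k / 2 ^ p" for y :: real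
  have "compact (h ` S)"
    unfolding h_def[abs_def] S_def
    by (intro compact_continuous_image compact_superlevel c continuous_intros)
  then have hS: "h ` S \<in> lmeasurable" by (rule lmeasurable_compact)
  \<comment> \<open>The image of 1 is the right endpoint, which the half-open cell lacks.\<close>
  have "{h 1} \<in> null_sets lebesgue" by (simp flip: negligible_iff_null_sets)
  then have "measure lebesgue (h ` S - {h 1}) = measure lebesgue (h ` S)"
    using hS by (intro measure_Diff_null_set) (rule fmeasurableD)
  also have "\<dots> = measure lebesgue S / 2 ^ p"
    using measure_lebesgue_affine[of "1 / 2 ^ p" "of_int k / 2 ^ p :: real" S] by (simp add: h_def[abs_def])
  finally have mT: "measure lebesgue (h ` S - {h 1}) = measure lebesgue S / 2 ^ p" .
  have "h ` S - {h 1} \<subseteq> cell p k \<inter> dyadic_superlevel t F (b - 1)"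
  proof
    fix x assume "x \<in> h ` S - {h 1}"
    then obtain y where y: "y \<in> S" "y \<noteq> 1" "x = h y" by blast
    have e: "2 ^ p * x = y + of_int k" using y(3) by (simp add: h_def field_simps)
    have y01: "0 \<le> y" "y < 1" using y by (auto simp: S_def)
    then have "\<lfloor>y\<rfloor> = 0" by linarith
    then have x: "x \<in> cell p k" by (simp add: mem_cell_iff e)
    then have x01: "x \<in> {0..<1}" using mem_unit_iff_floor[of x p] k by (simp add: mem_cell_iff)
    have "b - 1 \<le> F x" using F[OF x] per[of y k] y(1) by (simp add: e S_def)
    then show "x \<in> cell p k \<inter> dyadic_superlevel t F (b - 1)"
      using x x01 by (auto simp: dyadic_superlevel_def)
  qed
  then have "measure lebesgue (h ` S - {h 1}) \<le> measure lebesgue (cell p k \<inter> dyadic_superlevel t F (b - 1))"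
  proof (rule measure_mono_fmeasurable)
    show "h ` S - {h 1} \<in> sets lebesgue" using hS by (auto dest: fmeasurableD)
    show "cell p k \<inter> dyadic_superlevel t F (b - 1) \<in> lmeasurable"
      using cell_lmeasurable fmeasurableD[OF dyadic_lmeasurable[OF dyadic_dyadic_superlevel]] by (rule fmeasurable_Int_fmeasurable)
  qed
  moreover have "q / 2 ^ p \<le> measure lebesgue S / 2 ^ p"
    using q unfolding S_def by (rule divide_right_mono) simp
  ultimately show ?thesis using mT by linarith
qed

lemma abs_cos_diff_le: "\<bar>cos u - cos v\<bar> \<le> \<bar>u - v :: real\<bar>"
proof -
  have "\<bar>cos u - cos v\<bar> = 2 * \<bar>sin ((u + v) / 2)\<bar> * \<bar>sin ((v - u) / 2)\<bar>"
    unfolding cos_diff_cos by (simp add: abs_mult)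
  also have "\<dots> \<le> 2 * 1 * \<bar>(v - u) / 2\<bar>"
    by (intro mult_mono abs_sin_x_le_abs_x) auto
  finally show ?thesis by (simp add: abs_minus_commute)
qed

section \<open>Runs with offsets\<close>

text \<open>The contribution of one run to the sum of \<open>f\<close>: \<open>fst i\<close> is the
  position in the run, \<open>snd i\<close> the index of the cosine in \<open>f\<close>.\<close>

definition block_sum :: "nat \<Rightarrow> nat \<Rightarrow> nat \<Rightarrow> real \<Rightarrow> real" where
  "block_sum d e c x = (\<Sum>i\<in>{..<2*d}\<times>{..<d}. cos (2 * pi * 2 ^ snd i * ((2 ^ (e + fst i) + real c) * x)))"

lemma of_nat_le_power2: "n \<le> 2 ^ g \<Longrightarrow> real n \<le> 2 ^ g"
  using of_nat_le_iff[of n "2 ^ g", where 'a = real] by simp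

text \<open>On a cell that is short compared with the inverse of the offset, the offset only acts as a constant phase.\<close>

lemma block_sum_freeze:
  assumes x: "x \<in> cell p k" and p: "p \<le> e" and i: "i \<le> 2 ^ g"
  shows "\<bar>block_sum d e (2 ^ t * i) x
      - run_sum d (e - p) (\<lambda>j. 2 * pi * 2 ^ j * real i * frac (2 ^ t * (of_int k / 2 ^ p))) (2 ^ p * x)\<bar>
    \<le> 4 * pi * real d ^ 2 * 2 ^ (d + t + g) / 2 ^ p"
proof -
  define x0 where "x0 = of_int k / (2 ^ p :: real)"
  have x0: "\<bar>x - x0\<bar> \<le> 1 / 2 ^ p" using x by (auto simp: cell_def x0_def add_divide_distrib)
  define \<theta> where "\<theta> j = 2 * pi * 2 ^ j * real i * frac (2 ^ t * x0)" for j :: nat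
  have each: "\<bar>cos (2 * pi * 2 ^ j * ((2 ^ (e + s) + real (2 ^ t * i)) * x))
      - cos (2 * pi * of_int (2 ^ (e - p + s + j)) * (2 ^ p * x) + \<theta> j)\<bar> \<le> 2 * pi * 2 ^ (d + t + g) / 2 ^ p"
    if "j < d" for s j
  proof -
    \<comment> \<open>Whole turns of the phase at the left endpoint \<open>x0\<close>; they drop out
      of the cosine, leaving only the fractional part of \<open>2 ^ t * x0\<close>.\<close>
    define N where "N = (2 ^ j * int i) * \<lfloor>2 ^ t * x0\<rfloor>"
    have "2 ^ j * (2 ^ (e + s) + real (2 ^ t * i)) * x
        = 2 ^ (e + s + j) * x + 2 ^ j * 2 ^ t * real i * (x - x0) + 2 ^ j * real i * (2 ^ t * x0)"
      by (simp add: algebra_simps power_add)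
    also have "2 ^ t * x0 = frac (2 ^ t * x0) + of_int \<lfloor>2 ^ t * x0\<rfloor>" by (simp add: frac_def)
    finally have e0: "2 ^ j * (2 ^ (e + s) + real (2 ^ t * i)) * x
        = 2 ^ (e + s + j) * x + 2 ^ j * 2 ^ t * real i * (x - x0) + 2 ^ j * real i * (frac (2 ^ t * x0) + of_int \<lfloor>2 ^ t * x0\<rfloor>)" .
    have e1: "2 * pi * 2 ^ j * ((2 ^ (e + s) + real (2 ^ t * i)) * x)
        = (2 * pi * (2 ^ (e + s + j) * x) + \<theta> j + 2 * pi * (2 ^ j * 2 ^ t * real i * (x - x0))) + 2 * pi * of_int N"
    proof -
      have "2 * pi * 2 ^ j * ((2 ^ (e + s) + real (2 ^ t * i)) * x) = 2 * pi * (2 ^ j * (2 ^ (e + s) + real (2 ^ t * i)) * x)"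
        by (simp only: mult_ac)
      then show ?thesis unfolding e0 by (simp add: \<theta>_def N_def algebra_simps)
    qed
    have e2: "2 * pi * of_int (2 ^ (e - p + s + j)) * (2 ^ p * x) + \<theta> j = 2 * pi * (2 ^ (e + s + j) * x) + \<theta> j"
      using p by (simp flip: power_add mult.assoc)
    have c: "cos (u + 2 * pi * of_int N) = cos u" for u
      by (simp add: cos_add)
    have "\<bar>cos (2 * pi * 2 ^ j * ((2 ^ (e + s) + real (2 ^ t * i)) * x))
      - cos (2 * pi * of_int (2 ^ (e - p + s + j)) * (2 ^ p * x) + \<theta> j)\<bar>
      \<le> \<bar>2 * pi * (2 ^ j * 2 ^ t * real i * (x - x0))\<bar>"
      unfolding e1 e2 c by (rule order_trans[OF abs_cos_diff_le]) simp
    also have "\<dots> = 2 * pi * (2 ^ j * 2 ^ t * real i * \<bar>x - x0\<bar>)" by (simp add: abs_mult)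
    also have "\<dots> \<le> 2 * pi * (2 ^ d * 2 ^ t * 2 ^ g * (1 / 2 ^ p))"
      using x0 that of_nat_le_power2[OF i]
      by (intro mult_left_mono mult_mono) (auto intro: power_increasing)
    finally show ?thesis by (simp add: power_add)
  qed
  have "\<bar>block_sum d e (2 ^ t * i) x - run_sum d (e - p) \<theta> (2 ^ p * x)\<bar>
    \<le> (\<Sum>i\<in>{..<2*d}\<times>{..<d}. 2 * pi * 2 ^ (d + t + g) / 2 ^ p)"
    unfolding block_sum_def run_sum_def sum_subtractf[symmetric]
    by (rule order_trans[OF sum_abs], rule sum_mono) (use each in \<open>auto simp del: of_int_power of_nat_mult\<close>)
  also have "\<dots> = 4 * pi * real d ^ 2 * 2 ^ (d + t + g) / 2 ^ p"
    by (simp add: card_cartesian_product power2_eq_square)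
  finally show ?thesis unfolding \<theta>_def[abs_def] x0_def .
qed

lemma block_sum_lipschitz:
  assumes "c \<le> 2 ^ e" "d \<ge> 1"
  shows "\<bar>block_sum d e c x - block_sum d e c y\<bar> \<le> 4 * pi * real d ^ 2 * 2 ^ (3 * d + e) * \<bar>x - y\<bar>"
proof -
  have "\<bar>block_sum d e c x - block_sum d e c y\<bar> \<le> (\<Sum>i\<in>{..<2*d}\<times>{..<d}. 2 * pi * 2 ^ (3 * d + e) * \<bar>x - y\<bar>)"
    unfolding block_sum_def sum_subtractf[symmetric]
  proof (rule order_trans[OF sum_abs], rule sum_mono)
    fix i assume i: "i \<in> {..<2 * d} \<times> {..<d}"
    have c: "real c \<le> 2 ^ e" using assms(1) by (rule of_nat_le_power2)
    have "(2::real) ^ (e + fst i) + real c \<le> 2 ^ (e + (2 * d - 1)) + 2 ^ (e + (2 * d - 1))"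
    proof (rule add_mono)
      show "(2::real) ^ (e + fst i) \<le> 2 ^ (e + (2 * d - 1))" using i by (intro power_increasing) auto
      have "(2::real) ^ e \<le> 2 ^ (e + (2 * d - 1))" by (intro power_increasing) auto
      then show "real c \<le> 2 ^ (e + (2 * d - 1))" using c by linarith
    qed
    also have "\<dots> = 2 ^ Suc (e + (2 * d - 1))" by simp
    also have "Suc (e + (2 * d - 1)) = 2 * d + e" using assms(2) by simp
    finally have A: "(2::real) ^ (e + fst i) + real c \<le> 2 ^ (2 * d + e)" .
    have "\<bar>cos (2 * pi * 2 ^ snd i * ((2 ^ (e + fst i) + real c) * x)) - cos (2 * pi * 2 ^ snd i * ((2 ^ (e + fst i) + real c) * y))\<bar>
      \<le> \<bar>2 * pi * 2 ^ snd i * ((2 ^ (e + fst i) + real c) * x) - 2 * pi * 2 ^ snd i * ((2 ^ (e + fst i) + real c) * y)\<bar>"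
      by (rule abs_cos_diff_le)
    also have "\<dots> = \<bar>(2 * pi * 2 ^ snd i * (2 ^ (e + fst i) + real c)) * (x - y)\<bar>"
      by (rule arg_cong[where f = abs]) (simp add: algebra_simps)
    also have "\<dots> = 2 * pi * 2 ^ snd i * (2 ^ (e + fst i) + real c) * \<bar>x - y\<bar>"
      by (simp add: abs_mult)
    also have "\<dots> \<le> 2 * pi * 2 ^ d * 2 ^ (2 * d + e) * \<bar>x - y\<bar>"
      using i A by (intro mult_right_mono mult_mono) (auto intro: power_increasing)
    also have "2 * pi * 2 ^ d * 2 ^ (2 * d + e) * \<bar>x - y\<bar> = 2 * pi * 2 ^ (3 * d + e) * \<bar>x - y\<bar>"
      by (simp flip: power_add)
    finally show "\<bar>cos (2 * pi * 2 ^ snd i * ((2 ^ (e + fst i) + real c) * x)) - cos (2 * pi * 2 ^ snd i * ((2 ^ (e + fst i) + real c) * y))\<bar>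
      \<le> 2 * pi * 2 ^ (3 * d + e) * \<bar>x - y\<bar>" .
  qed
  then show ?thesis by (simp add: card_cartesian_product power2_eq_square mult_ac)
qed

text \<open>
  Run \<open>r\<close> (\<open>r = 0, 1, \<dots>\<close>) consists of the \<open>2 d\<close> numbers \<open>2 ^ (expo r + s) + off r\<close>, \<open>s < 2 d\<close>.
  Scale \<open>m\<close> consists of the runs \<open>r\<close> with \<open>P m \<le> r < P (m + 1)\<close>, split into \<open>G m\<close> groups of \<open>B m\<close>
  consecutive runs. Run \<open>r\<close> lives on the binary digits of \<open>x\<close> between \<open>\<tau> r\<close> and \<open>\<tau> (r + 1)\<close>, and the offsets
  of scale \<open>m\<close> are \<open>i * 2 ^ \<tau> (P m)\<close> for \<open>1 \<le> i \<le> 2 ^ g m\<close>, used cyclically. The width \<open>width m\<close> is chosen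
  so large that \<open>2 ^ width m\<close> exceeds all error terms.
\<close>

locale run_sequence =
  fixes d :: nat and G B g :: "nat \<Rightarrow> nat"
  assumes d: "d \<ge> 2" and B: "\<And>m. 2304 * d\<^sup>2 \<le> B m" and G: "\<And>m. 1 \<le> G m"
begin

definition P :: "nat \<Rightarrow> nat" where "P m = (\<Sum>i<m. G i * B i)"

text \<open>Factors of the error terms enter through \<open>n < 2 ^ n\<close>: \<open>13 d^2\<close>
  stands for \<open>4 pi d^2\<close> and \<open>P (Suc m)\<close> for the number of runs. The
  summand \<open>m\<close> eventually beats the fixed coefficients \<open>a\<close>,
  \<open>b\<close> in the counting.\<close>

definition width :: "nat \<Rightarrow> nat" where "width m = 3 * d + g m + m + 13 * d\<^sup>2 + P (Suc m) + 10"

definition scale :: "nat \<Rightarrow> nat" where "scale r = (LEAST m. r < P (Suc m))"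

definition \<tau> :: "nat \<Rightarrow> nat" where "\<tau> r = (\<Sum>i<r. 2 * width (scale i))"

text \<open>The exponent lies in the middle of the window of run \<open>r\<close>: the first half
  makes the offset constant on cells of level \<open>expo r\<close>, the second half makes the run
  itself nearly constant on cells of level \<open>\<tau> (Suc r)\<close>.\<close>

definition expo :: "nat \<Rightarrow> nat" where "expo r = \<tau> r + width (scale r)"

definition off :: "nat \<Rightarrow> nat" where "off r = 2 ^ \<tau> (P (scale r)) * (1 + r mod 2 ^ g (scale r))"

definition run_seq :: "nat \<Rightarrow> nat" where
  "run_seq k = 2 ^ (expo ((k - 1) div (2 * d)) + (k - 1) mod (2 * d)) + off ((k - 1) div (2 * d))"

lemma B_pos: "0 < B m" using B[of m] d by (cases "B m = 0") auto

lemma P_Suc: "P (Suc m) = P m + G m * B m" by (simp add: P_def)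

lemma P_less_Suc: "P m < P (Suc m)" using B_pos[of m] G[of m] by (simp add: P_Suc)

lemma P_strict_mono: "strict_mono P" by (simp add: strict_mono_Suc_iff P_less_Suc)

lemma P_ge: "m \<le> P m" by (rule strict_mono_imp_increasing[OF P_strict_mono])

lemma scale_bounds: "P (scale r) \<le> r" "r < P (Suc (scale r))"
proof -
  have "r < P (Suc r)" using P_ge[of "Suc r"] by simp
  then show 1: "r < P (Suc (scale r))" unfolding scale_def by (rule LeastI)
  show "P (scale r) \<le> r"
  proof (cases "scale r")
    case 0 then show ?thesis by (simp add: P_def)
  next
    case (Suc m)
    then have "\<not> r < P (Suc m)" unfolding scale_def by (metis Suc_n_not_le_n Least_le)
    then show ?thesis using Suc by simp
  qed
qed

lemma scale_eq: assumes "P m \<le> r" "r < P (Suc m)" shows "scale r = m"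
proof -
  have "P (scale r) < P (Suc m)" "P m < P (Suc (scale r))" using scale_bounds[of r] assms by linarith+
  then have "scale r < Suc m" "m < Suc (scale r)" using P_strict_mono by (auto simp: strict_mono_less)
  then show ?thesis by simp
qed

lemma \<tau>_Suc: "\<tau> (Suc r) = \<tau> r + 2 * width (scale r)" by (simp add: \<tau>_def)

lemma \<tau>_mono: "r \<le> r' \<Longrightarrow> \<tau> r \<le> \<tau> r'" by (rule lift_Suc_mono_le[of \<tau>]) (simp_all add: \<tau>_Suc)

lemma expo_Suc: "expo r + width (scale r) \<le> expo (Suc r)" "expo r + width (scale r) = \<tau> (Suc r)" by (simp_all add: expo_def \<tau>_Suc)

lemma expo_mono: "r \<le> r' \<Longrightarrow> expo r \<le> expo r'"
proof (rule lift_Suc_mono_le[of expo])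
  fix n show "expo n \<le> expo (Suc n)" using expo_Suc(1)[of n] by linarith
qed

lemma off_le: "off r \<le> 2 ^ (\<tau> (P (scale r)) + g (scale r))"
proof -
  have "1 + r mod 2 ^ g (scale r) \<le> 2 ^ g (scale r)"
    using mod_less_divisor[of "2 ^ g (scale r)" r] by (simp del: mod_less_divisor)
  then show ?thesis unfolding off_def power_add by (rule mult_le_mono2)
qed

lemma off_le_expo: "off r \<le> 2 ^ expo r"
proof -
  have "\<tau> (P (scale r)) + g (scale r) \<le> expo r"
    using \<tau>_mono[OF scale_bounds(1)[of r]] by (simp add: expo_def width_def)
  then show ?thesis using off_le[of r] by (meson le_trans one_le_numeral power_increasing)
qed

lemma two_power_width_ge: "4 * pi * real d ^ 2 * real (P (Suc m)) * 2 ^ (3 * d + g m) \<le> 2 ^ width m"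
proof -
  have "4 * pi * real d ^ 2 \<le> real (13 * d\<^sup>2)" using pi_less_4 pi_approx by (auto intro!: mult_right_mono)
  also have "\<dots> \<le> 2 ^ (13 * d\<^sup>2)" using of_nat_less_two_power[of "13 * d\<^sup>2"] by (intro less_imp_le)
  finally have a: "4 * pi * real d ^ 2 \<le> 2 ^ (13 * d\<^sup>2)" .
  have b: "real (P (Suc m)) \<le> 2 ^ P (Suc m)" using of_nat_less_two_power[of "P (Suc m)"] by (intro less_imp_le)
  have "4 * pi * real d ^ 2 * real (P (Suc m)) * 2 ^ (3 * d + g m) \<le> 2 ^ (13 * d\<^sup>2) * 2 ^ P (Suc m) * 2 ^ (3 * d + g m)"
    by (intro mult_right_mono mult_mono a b) auto
  also have "\<dots> = 2 ^ (13 * d\<^sup>2 + P (Suc m) + (3 * d + g m))" by (simp add: power_add)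
  also have "\<dots> \<le> 2 ^ width m" by (intro power_increasing) (auto simp: width_def)
  finally show ?thesis .
qed

section \<open>Events at one scale and their conditional probabilities\<close>

definition group_sum :: "nat \<Rightarrow> nat \<Rightarrow> real \<Rightarrow> real" where
  "group_sum m c x = (\<Sum>r<B m. block_sum d (expo (P m + c * B m + r)) (off (P m + c * B m + r)) x)"

text \<open>The 1 is lost by freezing the phases. Another 1 is lost by passing to dyadic sets,
  whence \<open>level m - 1\<close> later.\<close>

definition level :: "nat \<Rightarrow> real" where "level m = sqrt (real (B m) * real d ^ 3) / 12 - 1"

definition group_event :: "nat \<Rightarrow> nat \<Rightarrow> real set" where
  "group_event m c = dyadic_superlevel (\<tau> (P m + Suc c * B m)) (group_sum m c) (level m)"

text \<open>The number of zero digits absorbs the factors \<open>i \<le> 2 ^ g m\<close> and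
  \<open>2 ^ j \<le> 2 ^ d\<close> of the phases; the last 4 digits reduce \<open>2 pi\<close> to
  \<open>pi / 8\<close>, below the admissible \<open>pi / 6\<close>.\<close>

definition start_event :: "nat \<Rightarrow> real set" where
  "start_event m = zero_bits (\<tau> (P m)) (g m + d + 4)"

lemma group_index:
  assumes "c < G m" "r < B m"
  shows "scale (P m + c * B m + r) = m" "P m + c * B m + r < P (Suc m)"
proof -
  have "c * B m + r < Suc c * B m" using assms(2) by simp
  also have "\<dots> \<le> G m * B m" using assms(1) by (intro mult_le_mono1) simp
  finally show *: "P m + c * B m + r < P (Suc m)" by (simp add: P_Suc)
  show "scale (P m + c * B m + r) = m" by (rule scale_eq) (use * in auto)
qed

lemma B_le_P: "B m \<le> P (Suc m)"
proof -
  have "B m \<le> G m * B m" using G[of m] by (cases "G m") auto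
  then show ?thesis unfolding P_Suc by (rule trans_le_add2)
qed

text \<open>On a cell of the level of the first exponent of the group, all offsets are constant
  phases, small by the start event. Rescaled to the unit interval, the group is a sum of frozen runs
  to which \<open>group_sum_tail\<close> applies.\<close>

lemma group_event_measure_cell:
  assumes c: "c < G m" and k: "0 \<le> k" "k < 2 ^ expo (P m + c * B m)"
    and sub: "cell (expo (P m + c * B m)) k \<subseteq> start_event m"
  shows "(1 / 20) / 2 ^ expo (P m + c * B m) \<le> measure lebesgue (cell (expo (P m + c * B m)) k \<inter> group_event m c)"
proof -
  define r0 p t where "r0 = P m + c * B m" and "p = expo r0" and "t = \<tau> (P m)"
  define x0 where "x0 = of_int k / (2 ^ p :: real)"
  define i where "i r = 1 + (r0 + r) mod 2 ^ g m" for r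
  define \<theta> where "\<theta> r j = 2 * pi * 2 ^ j * real (i r) * frac (2 ^ t * x0)" for r j :: nat
  define Z where "Z y = (\<Sum>r<B m. run_sum d (expo (r0 + r) - p) (\<theta> r) y)" for y
  have sc: "scale (r0 + r) = m" if "r < B m" for r using group_index(1)[OF c that] by (simp add: r0_def)
  have off: "off (r0 + r) = 2 ^ t * i r" if "r < B m" for r
    using sc[OF that] by (simp add: off_def t_def i_def)
  have i: "i r \<le> 2 ^ g m" for r
    using mod_less_divisor[of "2 ^ g m" "r0 + r"] by (simp add: i_def del: mod_less_divisor)
  have pe: "p \<le> expo (r0 + r)" for r unfolding p_def by (rule expo_mono) simp
  have tp: "t + width m \<le> p"
    using \<tau>_mono[of "P m" r0] sc[of 0] B_pos by (simp add: p_def t_def r0_def expo_def)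
  \<comment> \<open>The left endpoint lies in the cell and hence in the start event, so the phases
    frozen at \<open>x0\<close> are small.\<close>
  have "x0 \<in> cell p k" by (simp add: x0_def cell_def field_simps)
  then have "x0 \<in> start_event m" using sub by (auto simp: p_def r0_def)
  then have fr: "frac (2 ^ t * x0) < 1 / 2 ^ (g m + d + 4)"
    unfolding start_event_def t_def by (rule zero_bits_frac)
  have th: "\<bar>\<theta> r j\<bar> \<le> pi / 6" if "j < d" for r j
  proof -
    have "\<bar>\<theta> r j\<bar> = 2 * pi * (2 ^ j * real (i r) * frac (2 ^ t * x0))"
      by (simp add: \<theta>_def abs_mult frac_ge_0)
    also have "\<dots> \<le> 2 * pi * (2 ^ d * 2 ^ g m * (1 / 2 ^ (g m + d + 4)))"
      using fr that of_nat_le_power2[OF i[of r]]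
      by (intro mult_left_mono mult_mono) (auto intro: power_increasing frac_ge_0)
    also have "\<dots> = pi / 8" by (simp add: power_add field_simps)
    finally show ?thesis by simp
  qed
  have tail: "1 / 20 \<le> measure lebesgue {y \<in> {0..1}. sqrt (real (B m) * real d ^ 3) / 12 \<le> Z y}"
    unfolding Z_def
  proof (rule group_sum_tail)
    show "1 \<le> d" using d by simp
    show "256 * d\<^sup>2 \<le> B m" using B[of m] by simp
    fix r assume r: "Suc r < B m"
    have "expo (r0 + r) + width m \<le> expo (r0 + Suc r)" using expo_Suc(1)[of "r0 + r"] sc[of r] r by simp
    then show "expo (r0 + r) - p + 3 * d + 2 \<le> expo (r0 + Suc r) - p" using pe[of r] by (simp add: width_def)
  qed (use th in auto)
  have freeze: "Z (2 ^ p * x) - 1 \<le> group_sum m c x" if x: "x \<in> cell p k" for x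
  proof -
    have "\<bar>group_sum m c x - Z (2 ^ p * x)\<bar> \<le> (\<Sum>r<B m. 4 * pi * real d ^ 2 * 2 ^ (d + t + g m) / 2 ^ p)"
      unfolding group_sum_def Z_def r0_def[symmetric] sum_subtractf[symmetric]
    proof (rule order_trans[OF sum_abs], rule sum_mono)
      fix r assume "r \<in> {..<B m}"
      then have r: "r < B m" by simp
      show "\<bar>block_sum d (expo (r0 + r)) (off (r0 + r)) x - run_sum d (expo (r0 + r) - p) (\<theta> r) (2 ^ p * x)\<bar>
        \<le> 4 * pi * real d ^ 2 * 2 ^ (d + t + g m) / 2 ^ p"
        unfolding off[OF r] \<theta>_def[abs_def] x0_def by (rule block_sum_freeze[OF x pe i])
    qed
    also have "\<dots> = 4 * pi * real d ^ 2 * real (B m) * 2 ^ (d + g m) * 2 ^ t / 2 ^ p"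
      by (simp add: power_add)
    also have "\<dots> \<le> 4 * pi * real d ^ 2 * real (P (Suc m)) * 2 ^ (3 * d + g m) * 2 ^ t / 2 ^ p"
      using B_le_P[of m] by (intro divide_right_mono mult_right_mono mult_mono) (auto intro: power_increasing)
    also have "\<dots> \<le> 2 ^ width m * 2 ^ t / 2 ^ p"
      by (intro divide_right_mono mult_right_mono two_power_width_ge) auto
    also have "\<dots> \<le> 1" using power_increasing[OF tp, of "2::real"] by (simp add: power_add mult.commute)
    finally show ?thesis by linarith
  qed
  have per: "Z (y + of_int n) = Z y" for y n
  proof -
    have "cos (2 * pi * of_int a * (y + of_int n) + u) = cos (2 * pi * of_int a * y + u)" for a u
    proof -
      have "2 * pi * of_int a * (y + of_int n) + u = (2 * pi * of_int a * y + u) + 2 * pi * of_int (a * n)"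
        by (simp add: algebra_simps)
      also have "cos \<dots> = cos (2 * pi * of_int a * y + u)" by (subst cos_add) (simp del: of_int_mult)
      finally show ?thesis .
    qed
    then show ?thesis unfolding Z_def run_sum_def by (simp only:)
  qed
  have cont: "continuous_on {0..1} Z" unfolding Z_def[abs_def] run_sum_def[abs_def] by (intro continuous_intros)
  have "(1 / 20) / 2 ^ p \<le> measure lebesgue (cell p k \<inter>
      dyadic_superlevel (\<tau> (P m + Suc c * B m)) (group_sum m c) (sqrt (real (B m) * real d ^ 3) / 12 - 1))"
    using k by (intro measure_cell_superlevel_ge[OF per _ _ cont freeze tail]) (auto simp: p_def r0_def)
  then show ?thesis by (simp only: group_event_def level_def p_def r0_def)
qed

lemma group_event_lower:
  assumes c: "c < G m" and x: "x \<in> group_event m c"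
  shows "level m - 1 \<le> group_sum m c x"
proof -
  define r0 where "r0 = P m + c * B m"
  define e where "e = expo (r0 + (B m - 1))"
  have sc: "scale (r0 + r) = m" if "r < B m" for r using group_index(1)[OF c that] by (simp add: r0_def)
  have r0: "P m + Suc c * B m = Suc (r0 + (B m - 1))" using B_pos[of m] by (simp add: r0_def)
  then have t: "\<tau> (P m + Suc c * B m) = e + width m"
    unfolding r0 e_def using expo_Suc(2)[of "r0 + (B m - 1)"] sc[of "B m - 1"] B_pos[of m] by simp
  show ?thesis
  proof (rule dyadic_superlevel_lower[OF x[unfolded group_event_def]])
    fix x y
    have "\<bar>group_sum m c x - group_sum m c y\<bar> \<le> (\<Sum>r<B m. 4 * pi * real d ^ 2 * 2 ^ (3 * d + e) * \<bar>x - y\<bar>)"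
      unfolding group_sum_def r0_def[symmetric] sum_subtractf[symmetric]
    proof (rule order_trans[OF sum_abs], rule sum_mono)
      fix r assume "r \<in> {..<B m}"
      then have r: "r \<le> B m - 1" by simp
      have "\<bar>block_sum d (expo (r0 + r)) (off (r0 + r)) x - block_sum d (expo (r0 + r)) (off (r0 + r)) y\<bar>
        \<le> 4 * pi * real d ^ 2 * 2 ^ (3 * d + expo (r0 + r)) * \<bar>x - y\<bar>"
        using d by (intro block_sum_lipschitz off_le_expo) auto
      also have "\<dots> \<le> 4 * pi * real d ^ 2 * 2 ^ (3 * d + e) * \<bar>x - y\<bar>"
        unfolding e_def using r by (intro mult_right_mono mult_left_mono power_increasing add_left_mono expo_mono) auto
      finally show "\<bar>block_sum d (expo (r0 + r)) (off (r0 + r)) x - block_sum d (expo (r0 + r)) (off (r0 + r)) y\<bar>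
        \<le> 4 * pi * real d ^ 2 * 2 ^ (3 * d + e) * \<bar>x - y\<bar>" .
    qed
    then show "\<bar>group_sum m c x - group_sum m c y\<bar> \<le> real (B m) * (4 * pi * real d ^ 2 * 2 ^ (3 * d + e)) * \<bar>x - y\<bar>"
      by simp
  next
    have "real (B m) * (4 * pi * real d ^ 2 * 2 ^ (3 * d + e)) = 4 * pi * real d ^ 2 * real (B m) * 2 ^ (3 * d) * 2 ^ e"
      by (simp add: power_add)
    also have "\<dots> \<le> 4 * pi * real d ^ 2 * real (P (Suc m)) * 2 ^ (3 * d + g m) * 2 ^ e"
      using B_le_P[of m] by (intro mult_right_mono mult_mono) (auto intro: power_increasing)
    also have "\<dots> \<le> 2 ^ width m * 2 ^ e" by (intro mult_right_mono two_power_width_ge) auto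
    also have "\<dots> = 2 ^ (e + width m)" by (simp add: power_add)
    finally show "real (B m) * (4 * pi * real d ^ 2 * 2 ^ (3 * d + e)) \<le> 2 ^ \<tau> (P m + Suc c * B m)"
      by (simp only: t)
  qed auto
qed

definition scale_event :: "nat \<Rightarrow> real set" where
  "scale_event m = start_event m \<inter> (\<Inter>c<G m. group_event m c)"

text \<open>Induction over the groups: the start event and the earlier groups are decided by digits
  before the first exponent of group \<open>c\<close>, so each group costs a factor 1/20.\<close>

lemma scale_event_measure:
  assumes U: "dyadic (\<tau> (P m)) U"
  shows "1 / 2 ^ (g m + d + 4) * (1 / 20) ^ G m * measure lebesgue U \<le> measure lebesgue (U \<inter> scale_event m)
    \<and> dyadic (\<tau> (P (Suc m))) (U \<inter> scale_event m)"
proof -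
  define V where "V c = U \<inter> start_event m \<inter> (\<Inter>b<c. group_event m b)" for c
  have V_Suc: "V (Suc c) = V c \<inter> group_event m c" for c by (auto simp: V_def less_Suc_eq)
  \<comment> \<open>The maximum matters only for \<open>c = 0\<close>, where the zero digits reach
    beyond \<open>\<tau> (P m)\<close>; later they lie inside the first window.\<close>
  have "c \<le> G m \<Longrightarrow> 1 / 2 ^ (g m + d + 4) * (1 / 20) ^ c * measure lebesgue U \<le> measure lebesgue (V c)
     \<and> dyadic (max (\<tau> (P m) + (g m + d + 4)) (\<tau> (P m + c * B m))) (V c)" for c
  proof (induction c)
    case 0
    have V0: "V 0 = U \<inter> zero_bits (\<tau> (P m)) (g m + d + 4)" by (simp add: V_def start_event_def)
    have "dyadic (\<tau> (P m) + (g m + d + 4)) (V 0)"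
      unfolding V0 by (intro dyadic_Int dyadic_zero_bits dyadic_mono[OF U]) simp
    moreover have "max (\<tau> (P m) + (g m + d + 4)) (\<tau> (P m + 0 * B m)) = \<tau> (P m) + (g m + d + 4)" by simp
    ultimately show ?case using measure_zero_bits[OF U, of "g m + d + 4"] V0 by (simp only:) simp
  next
    case (Suc c)
    have c: "c < G m" using Suc.prems by simp
    have IH: "1 / 2 ^ (g m + d + 4) * (1 / 20) ^ c * measure lebesgue U \<le> measure lebesgue (V c)"
      "dyadic (max (\<tau> (P m) + (g m + d + 4)) (\<tau> (P m + c * B m))) (V c)" using Suc by auto
    have sc: "scale (P m + c * B m) = m" using group_index(1)[OF c B_pos] by simp
    have tm: "\<tau> (P m) \<le> \<tau> (P m + c * B m)" by (rule \<tau>_mono) simp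
    have e: "expo (P m + c * B m) = \<tau> (P m + c * B m) + width m" using sc by (simp add: expo_def)
    have le: "max (\<tau> (P m) + (g m + d + 4)) (\<tau> (P m + c * B m)) \<le> expo (P m + c * B m)"
      using tm unfolding e by (auto simp: width_def)
    have dV: "dyadic (expo (P m + c * B m)) (V c)" by (rule dyadic_mono[OF IH(2) le])
    have "expo (P m + c * B m) \<le> \<tau> (Suc (P m + c * B m))" using expo_Suc(2)[of "P m + c * B m"] by linarith
    also have "\<dots> \<le> \<tau> (P m + Suc c * B m)" using B_pos[of m] by (intro \<tau>_mono) simp
    finally have le2: "expo (P m + c * B m) \<le> \<tau> (P m + Suc c * B m)" .
    have mx: "max (\<tau> (P m) + (g m + d + 4)) (\<tau> (P m + Suc c * B m)) = \<tau> (P m + Suc c * B m)"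
      using le le2 by linarith
    have "1 / 20 * measure lebesgue (V c) \<le> measure lebesgue (V c \<inter> group_event m c)"
    proof (rule dyadic_measure_Int_ge[OF dV])
      show "group_event m c \<in> sets lebesgue"
        unfolding group_event_def using dyadic_lmeasurable[OF dyadic_dyadic_superlevel] by (rule fmeasurableD)
      fix k :: int assume "0 \<le> k" "k < 2 ^ expo (P m + c * B m)" "cell (expo (P m + c * B m)) k \<subseteq> V c"
      then show "1 / 20 / 2 ^ expo (P m + c * B m) \<le> measure lebesgue (cell (expo (P m + c * B m)) k \<inter> group_event m c)"
        by (intro group_event_measure_cell[OF c]) (auto simp: V_def)
    qed
    moreover have "1 / 20 * (1 / 2 ^ (g m + d + 4) * (1 / 20) ^ c * measure lebesgue U) \<le> 1 / 20 * measure lebesgue (V c)"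
      using IH(1) by (rule mult_left_mono) simp
    ultimately have "1 / 20 * (1 / 2 ^ (g m + d + 4) * (1 / 20) ^ c * measure lebesgue U) \<le> measure lebesgue (V (Suc c))"
      unfolding V_Suc by linarith
    moreover have "1 / 20 * (1 / 2 ^ (g m + d + 4) * (1 / 20) ^ c * measure lebesgue U)
      = 1 / 2 ^ (g m + d + 4) * (1 / 20) ^ Suc c * measure lebesgue U" by (simp only: power_Suc mult_ac)
    moreover have "dyadic (\<tau> (P m + Suc c * B m)) (V (Suc c))"
      unfolding V_Suc by (intro dyadic_Int dyadic_mono[OF dV le2]) (simp only: group_event_def dyadic_dyadic_superlevel)
    ultimately show ?case unfolding mx by (simp only:) 
  qed
  from this[of "G m"] have *: "1 / 2 ^ (g m + d + 4) * (1 / 20) ^ G m * measure lebesgue U \<le> measure lebesgue (V (G m))"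
     "dyadic (max (\<tau> (P m) + (g m + d + 4)) (\<tau> (P (Suc m)))) (V (G m))" by (auto simp: P_Suc)
  have "\<tau> (P m) + (g m + d + 4) \<le> expo (P m)" using scale_eq[of m "P m"] P_less_Suc by (simp add: expo_def width_def)
  also have "\<dots> \<le> \<tau> (Suc (P m))" using expo_Suc(2)[of "P m"] by linarith
  also have "\<dots> \<le> \<tau> (P (Suc m))" using P_less_Suc[of m] by (intro \<tau>_mono) simp
  finally have "max (\<tau> (P m) + (g m + d + 4)) (\<tau> (P (Suc m))) = \<tau> (P (Suc m))" by simp
  moreover have "V (G m) = U \<inter> scale_event m" by (auto simp: V_def scale_event_def)
  ultimately show ?thesis using * by (simp only:)
qed

lemma scale_event_lower:
  assumes "x \<in> scale_event m"
  shows "real (G m) * (level m - 1) \<le> (\<Sum>r\<in>{P m..<P (Suc m)}. block_sum d (expo r) (off r) x)"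
proof -
  have "(\<Sum>r\<in>{P m..<P m + n * B m}. block_sum d (expo r) (off r) x) = (\<Sum>c<n. group_sum m c x)" for n
  proof (induction n)
    case (Suc n)
    have "{P m..<P m + Suc n * B m} = {P m..<P m + n * B m} \<union> {P m + n * B m..<P m + n * B m + B m}" by auto
    then have "(\<Sum>r\<in>{P m..<P m + Suc n * B m}. block_sum d (expo r) (off r) x) =
       (\<Sum>r\<in>{P m..<P m + n * B m}. block_sum d (expo r) (off r) x)
       + (\<Sum>r\<in>{P m + n * B m..<P m + n * B m + B m}. block_sum d (expo r) (off r) x)"
      by (simp only:) (rule sum.union_disjoint, auto)
    also have "(\<Sum>r\<in>{P m + n * B m..<P m + n * B m + B m}. block_sum d (expo r) (off r) x) = group_sum m n x"
      unfolding group_sum_def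
      by (rule sum.reindex_bij_witness[of _ "\<lambda>r. P m + n * B m + r" "\<lambda>r. r - (P m + n * B m)"]) auto
    finally show ?case using Suc by simp
  qed simp
  from this[of "G m"] have "(\<Sum>r\<in>{P m..<P (Suc m)}. block_sum d (expo r) (off r) x) = (\<Sum>c<G m. group_sum m c x)"
    by (simp add: P_Suc)
  moreover have "(\<Sum>c<G m. level m - 1) \<le> (\<Sum>c<G m. group_sum m c x)"
    using assms by (intro sum_mono group_event_lower) (auto simp: scale_event_def)
  ultimately show ?thesis by simp
qed

lemma scale_events_infinitely_often:
  assumes "\<not> summable (\<lambda>m. 1 / 2 ^ (g m + d + 4) * (1 / 20) ^ G m :: real)"
  shows "negligible {x \<in> {0..<1}. finite {m. x \<in> scale_event m}}"
proof (rule dyadic_borel_cantelli[where \<tau> = "\<lambda>m. \<tau> (P m)", OF _ _ _ _ assms])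
  show "\<tau> (P m) \<le> \<tau> (P (Suc m))" for m using P_less_Suc[of m] by (intro \<tau>_mono) simp
  have "scale_event m \<subseteq> {0..<1}" for m by (auto simp: scale_event_def start_event_def zero_bits_def)
  then have eq: "{0..<1} \<inter> scale_event m = scale_event m" for m by blast
  show "dyadic (\<tau> (P (Suc m))) (scale_event m)" for m
    using scale_event_measure[OF dyadic_unit, of m] unfolding eq by blast
qed (use scale_event_measure in auto)

end

section \<open>Lacunarity and counting of solutions\<close>

lemma card_residue_class_le:
  fixes D X i :: nat
  assumes "D > 0" shows "card {r. r < X \<and> r mod D = i} \<le> X div D + 1"
proof -
  have "inj_on (\<lambda>r. r div D) {r. r < X \<and> r mod D = i}"
    by (rule inj_onI) (metis (mono_tags, lifting) div_mult_mod_eq mem_Collect_eq)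
  moreover have "(\<lambda>r. r div D) ` {r. r < X \<and> r mod D = i} \<subseteq> {..X div D}"
    by (auto intro: div_le_mono)
  ultimately have "card {r. r < X \<and> r mod D = i} \<le> card {..X div D}"
    by (meson card_inj_on_le finite_atMost)
  then show ?thesis by simp
qed

context run_sequence
begin

definition run_of :: "nat \<Rightarrow> nat" where "run_of k = (k - 1) div (2 * d)"

lemma run_seq_eq: "run_seq k = 2 ^ (expo (run_of k) + (k - 1) mod (2 * d)) + off (run_of k)"
  by (simp add: run_seq_def run_of_def)

lemma mod_less: "(k - 1) mod (2 * d) < 2 * d" using d by simp

lemma run_of_index:
  assumes "s < 2 * d"
  shows "run_of (Suc (2 * d * r + s)) = r" "(Suc (2 * d * r + s) - 1) mod (2 * d) = s"
proof -
  have "(s + 2 * d * r) div (2 * d) = r" using assms by (subst div_mult_self2) auto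
  then show "run_of (Suc (2 * d * r + s)) = r" by (simp add: run_of_def add.commute)
  have "(s + 2 * d * r) mod (2 * d) = s" using assms by (subst mod_mult_self2) auto
  then show "(Suc (2 * d * r + s) - 1) mod (2 * d) = s" by (simp add: add.commute)
qed

lemma run_seq_ge: "2 ^ expo (run_of k) \<le> run_seq k"
  unfolding run_seq_eq by (rule trans_le_add1) simp

lemma run_seq_le: "run_seq k \<le> 2 ^ (expo (run_of k) + 2 * d)"
proof -
  define e where "e = expo (run_of k)"
  have "(2::nat) ^ (e + (k - 1) mod (2 * d)) \<le> 2 ^ (e + (2 * d - 1))"
    using mod_less[of k] by (intro power_increasing) auto
  moreover have "off (run_of k) \<le> 2 ^ (e + (2 * d - 1))"
    unfolding e_def by (rule le_trans[OF off_le_expo], rule power_increasing) auto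
  ultimately have "run_seq k \<le> 2 ^ (e + (2 * d - 1)) + 2 ^ (e + (2 * d - 1))"
    unfolding run_seq_eq e_def by (rule add_mono)
  also have "\<dots> = 2 ^ Suc (e + (2 * d - 1))" by simp
  also have "Suc (e + (2 * d - 1)) = e + 2 * d" using d by simp
  finally show ?thesis by (simp add: e_def)
qed

text \<open>Inside a run the ratio is \<open>(2 u + c) / (u + c)\<close> with
  \<open>c \<le> u\<close>, hence at least 3/2; between runs the width of the windows leaves ample
  room.\<close>

lemma run_seq_growth: assumes "k \<ge> 1" shows "3 * run_seq k \<le> 2 * run_seq (Suc k)"
proof -
  define r s where "r = run_of k" and "s = (k - 1) mod (2 * d)"
  have k: "k = Suc (2 * d * r + s)" using assms by (simp add: r_def s_def run_of_def)
  have s: "s < 2 * d" using mod_less s_def by simp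
  show ?thesis
  proof (cases "Suc s < 2 * d")
    case True
    have r': "run_of (Suc k) = r" "(Suc k - 1) mod (2 * d) = Suc s"
      using run_of_index[OF True, of r] unfolding k by simp_all
    have o: "off r \<le> 2 ^ (expo r + s)" by (rule le_trans[OF off_le_expo], rule power_increasing) auto
    have "run_seq k = 2 ^ (expo r + s) + off r" by (simp add: run_seq_eq r_def s_def)
    moreover have "run_seq (Suc k) = 2 * 2 ^ (expo r + s) + off r" unfolding run_seq_eq r' by simp
    ultimately show ?thesis using o by simp
  next
    case False
    then have "s = 2 * d - 1" using s by simp
    then have k': "k = 2 * d * Suc r" using k d by simp
    have r': "run_of (Suc k) = Suc r" using d by (simp add: run_of_def k')
    have "3 * run_seq k \<le> 4 * 2 ^ (expo r + 2 * d)" using run_seq_le[of k] by (simp add: r_def)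
    also have "\<dots> = 2 * 2 ^ (expo r + 2 * d + 1)" by simp
    also have "\<dots> \<le> 2 * 2 ^ expo (Suc r)"
      using expo_Suc(1)[of r] by (intro mult_le_mono2 power_increasing) (auto simp: width_def)
    also have "\<dots> \<le> 2 * run_seq (Suc k)" using run_seq_ge[of "Suc k"] r' by simp
    finally show ?thesis .
  qed
qed

lemma run_seq_pos: "0 < run_seq k"
  using run_seq_ge[of k] by (meson less_le_trans zero_less_numeral zero_less_power)

lemma lacunary_run_seq: "lacunary run_seq"
  unfolding lacunary_def pos_seq_def
proof (intro conjI allI impI exI[of _ "3 / 2 :: real"])
  fix k :: nat assume "k \<ge> 1"
  from run_seq_growth[OF this] have "3 * real (run_seq k) \<le> 2 * real (run_seq (k + 1))"
    by (metis Suc_eq_plus1 of_nat_le_iff of_nat_mult of_nat_numeral)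
  then show "3 / 2 \<le> real (run_seq (k + 1)) / real (run_seq k)"
    using run_seq_pos[of k] by (simp add: field_simps)
qed (use run_seq_pos in auto)

section \<open>Counting solutions of \<open>a n_k - b n_l = c\<close>\<close>

lemma run_seq_inj: "inj_on run_seq {1..}"
proof -
  have "run_seq k < run_seq (Suc k)" if "k \<ge> 1" for k
    using run_seq_growth[OF that] run_seq_pos[of k] by linarith
  then have "strict_mono (\<lambda>k. run_seq (Suc k))" by (simp add: strict_mono_Suc_iff)
  then have i: "inj (\<lambda>k. run_seq (Suc k))" by (rule strict_mono_imp_inj_on)
  show ?thesis
  proof (rule inj_onI)
    fix x y assume "x \<in> {1..}" "y \<in> {1..}" "run_seq x = run_seq y"
    then show "x = y" using injD[OF i, of "x - 1" "y - 1"] by auto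
  qed
qed

text \<open>Offsets of a scale lie below the power of two that divides those of any later scale.
  Hence the runs sharing one offset form a residue class within one scale.\<close>

lemma off_eq_imp:
  assumes "off r = off r'"
  shows "scale r = scale r'" "r mod 2 ^ g (scale r) = r' mod 2 ^ g (scale r)"
proof -
  have "\<not> off r < off r'" "\<not> off r' < off r" using assms by auto
  moreover have "off u < off v" if "scale u < scale v" for u v
  proof -
    have "\<tau> (P (scale u)) + g (scale u) < \<tau> (P (scale u)) + 2 * width (scale u)" by (simp add: width_def)
    also have "\<dots> = \<tau> (Suc (P (scale u)))" using scale_eq[of "scale u" "P (scale u)"] P_less_Suc by (simp add: \<tau>_Suc)
    also have "\<dots> \<le> \<tau> (P (Suc (scale u)))" using P_less_Suc[of "scale u"] by (intro \<tau>_mono) simp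
    also have "\<dots> \<le> \<tau> (P (scale v))" using that P_strict_mono by (intro \<tau>_mono) (simp add: strict_mono_less_eq)
    finally have "(2::nat) ^ (\<tau> (P (scale u)) + g (scale u)) < 2 ^ \<tau> (P (scale v))" by simp
    also have "\<dots> \<le> off v" by (simp add: off_def)
    finally show ?thesis using off_le[of u] by linarith
  qed
  ultimately show 1: "scale r = scale r'" by (meson linorder_neqE_nat)
  show "r mod 2 ^ g (scale r) = r' mod 2 ^ g (scale r)" using assms by (simp add: off_def 1)
qed

lemma run_of_le: "run_of k \<le> k - 1" by (simp add: run_of_def)

lemma card_run_of: "card {k. 1 \<le> k \<and> run_of k = r} \<le> 2 * d" "finite {k. 1 \<le> k \<and> run_of k = r}"
proof -
  have sub: "{k. 1 \<le> k \<and> run_of k = r} \<subseteq> {Suc (2 * d * r)..<Suc (2 * d * r) + 2 * d}"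
  proof
    fix k assume "k \<in> {k. 1 \<le> k \<and> run_of k = r}"
    then have k: "1 \<le> k" "(k - 1) div (2 * d) = r" by (auto simp: run_of_def)
    have "k - 1 = 2 * d * r + (k - 1) mod (2 * d)" unfolding k(2)[symmetric] by simp
    then show "k \<in> {Suc (2 * d * r)..<Suc (2 * d * r) + 2 * d}" using k(1) mod_less[of k]
      unfolding atLeastLessThan_iff by linarith
  qed
  show "finite {k. 1 \<le> k \<and> run_of k = r}" using sub by (rule finite_subset) simp
  show "card {k. 1 \<le> k \<and> run_of k = r} \<le> 2 * d" using card_mono[OF _ sub] by simp
qed

lemma scale_ge: "P m \<le> r \<Longrightarrow> m \<le> scale r"
  using scale_bounds(2)[of r] P_strict_mono by (metis le_less_trans less_Suc_eq_le strict_mono_less)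

text \<open>
  Unless the leading powers of two cancel inside one run, the difference \<open>c\<close> determines the later of
  the two runs involved.
\<close>

lemma resonance_range:
  assumes ab: "1 \<le> a" "1 \<le> b"
    and eq: "int a * int (run_seq k) - int b * int (run_seq l) = int c"
    and r: "r = max (run_of k) (run_of l)" and large: "P (4 * max a b) \<le> r"
    and non: "\<not> (run_of k = run_of l \<and> (int a - int b) * int (off (run_of k)) = int c)"
  shows "2 ^ \<tau> r \<le> c \<and> c < 2 ^ \<tau> (Suc r)"
proof -
  define M where "M = max a b"
  have M: "a \<le> M" "b \<le> M" "1 \<le> M" using ab by (auto simp: M_def)
  \<comment> \<open>Beyond the threshold the scale is so late that its width outweighs the
    coefficients \<open>a\<close> and \<open>b\<close>.\<close>
  have sc: "4 * M \<le> scale r" using scale_ge large by (simp add: M_def)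
  have "4 * M < 2 ^ scale r" using sc less_exp[of "scale r"] by linarith
  then have pM: "4 * M \<le> 2 ^ scale r" by simp
  have eqn: "a * run_seq k = b * run_seq l + c" using eq by (metis add_diff_cancel_left' diff_add_cancel of_nat_add of_nat_eq_iff of_nat_mult)
  have ek: "expo (run_of k) \<le> expo r" using r by (intro expo_mono) simp
  have "c \<le> a * run_seq k" using eqn by simp
  also have "\<dots> \<le> M * 2 ^ (expo (run_of k) + 2 * d)" by (intro mult_le_mono M run_seq_le)
  also have "\<dots> \<le> M * 2 ^ (expo r + 2 * d)" using ek by (intro mult_le_mono2 power_increasing) auto
  also have "\<dots> < (4 * M) * 2 ^ (expo r + 2 * d)" using M by simp
  also have "\<dots> \<le> 2 ^ scale r * 2 ^ (expo r + 2 * d)" by (intro mult_le_mono1 pM)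
  also have "\<dots> = 2 ^ (scale r + (expo r + 2 * d))" by (simp add: power_add)
  also have "\<dots> \<le> 2 ^ \<tau> (Suc r)" unfolding expo_Suc(2)[symmetric] by (intro power_increasing) (auto simp: width_def)
  finally have upper: "c < 2 ^ \<tau> (Suc r)" .
  have tau: "2 * 2 ^ \<tau> r \<le> (2::nat) ^ expo r"
    using power_increasing[of "Suc (\<tau> r)" "expo r" "2::nat"] by (simp add: expo_def width_def)
  \<comment> \<open>Terms of an earlier run are negligible even after multiplication by a
    coefficient. As \<open>c \<ge> 0\<close>, the later run must then be that of
    \<open>k\<close>.\<close>
  have cross: "2 * (M * 2 ^ (expo u + 2 * d)) \<le> 2 ^ expo r" if "u < r" for u
  proof -
    have "2 * (M * 2 ^ (expo u + 2 * d)) \<le> 4 * M * 2 ^ (expo u + 2 * d)" by simp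
    also have "\<dots> \<le> 2 ^ scale r * 2 ^ (expo u + 2 * d)" by (intro mult_le_mono1 pM)
    also have "\<dots> = 2 ^ (scale r + (expo u + 2 * d))" by (simp add: power_add)
    also have "\<dots> \<le> 2 ^ expo r"
    proof (intro power_increasing)
      have "expo u + width (scale u) \<le> \<tau> r" unfolding expo_Suc(2) using that by (intro \<tau>_mono) simp
      moreover have "expo r = \<tau> r + width (scale r)" by (simp add: expo_def)
      moreover have "2 * d + scale r \<le> width (scale r)" by (simp add: width_def)
      ultimately show "scale r + (expo u + 2 * d) \<le> expo r" by linarith
    qed simp
    finally show ?thesis .
  qed
  have aseq: "a * run_seq k \<le> M * 2 ^ (expo (run_of k) + 2 * d)" by (intro mult_le_mono M run_seq_le)
  have bseq: "b * run_seq l \<le> M * 2 ^ (expo (run_of l) + 2 * d)" by (intro mult_le_mono M run_seq_le)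
  have aseq': "2 ^ expo (run_of k) \<le> a * run_seq k" using ab run_seq_ge[of k] mult_le_mono[of 1 a "2 ^ expo (run_of k)" "run_seq k"] by simp
  have bseq': "2 ^ expo (run_of l) \<le> b * run_seq l" using ab run_seq_ge[of l] mult_le_mono[of 1 b "2 ^ expo (run_of l)" "run_seq l"] by simp
  have pos: "(0::nat) < 2 ^ expo r" by simp
  consider "run_of l < run_of k" | "run_of k < run_of l" | "run_of k = run_of l" by linarith
  then have "2 ^ \<tau> r \<le> c"
  proof cases
    case 1
    then have "r = run_of k" using r by simp
    then show ?thesis using cross[of "run_of l"] 1 bseq aseq' eqn tau by simp
  next
    case 2
    then have rl: "r = run_of l" using r by simp
    have "2 * (M * 2 ^ (expo (run_of k) + 2 * d)) \<le> 2 ^ expo r" using cross[of "run_of k"] 2 rl by simp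
    then have False using aseq bseq'[folded rl] eqn pos by linarith
    then show ?thesis ..
  next
    case 3
    then have rk: "run_of k = r" "run_of l = r" using r by auto
    define s s' where "s = (k - 1) mod (2 * d)" and "s' = (l - 1) mod (2 * d)"
    \<comment> \<open>Within one run \<open>c = E z + y\<close>, where \<open>y\<close> comes from
      the offset and is at most \<open>E / 4\<close>. The excluded case is \<open>z = 0\<close>, and
      \<open>c \<ge> 0\<close> then forces \<open>z \<ge> 1\<close>.\<close>
    define E z where "E = (2::int) ^ expo r" and "z = int a * 2 ^ s - int b * 2 ^ s'"
    define y where "y = (int a - int b) * int (off r)"
    have c: "int c = E * z + y"
      using eq unfolding run_seq_eq rk s_def[symmetric] s'_def[symmetric] E_def z_def y_def
      by (simp add: power_add algebra_simps)
    have z: "z \<noteq> 0" using c non rk by (auto simp: y_def)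
    have "\<bar>y\<bar> = \<bar>int a - int b\<bar> * int (off r)" by (simp add: y_def abs_mult)
    also have "\<dots> \<le> int M * int (off r)" using ab M by (intro mult_right_mono) auto
    also have "4 * \<dots> \<le> E"
    proof -
      have "4 * (M * off r) \<le> 2 ^ scale r * 2 ^ (\<tau> (P (scale r)) + g (scale r))"
        using mult_le_mono[OF pM off_le[of r]] by simp
      also have "\<dots> = 2 ^ (scale r + (\<tau> (P (scale r)) + g (scale r)))" by (simp add: power_add)
      also have "\<dots> \<le> 2 ^ expo r"
        using \<tau>_mono[OF scale_bounds(1)[of r]] by (intro power_increasing) (auto simp: expo_def width_def)
      finally have "int (4 * (M * off r)) \<le> int (2 ^ expo r)" by (simp only: of_nat_le_iff)
      then show ?thesis by (simp add: E_def)
    qed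
    finally have y: "4 * \<bar>y\<bar> \<le> E" by simp
    have E: "E > 0" by (simp add: E_def)
    have "z \<ge> 1"
    proof (rule ccontr)
      assume "\<not> 1 \<le> z"
      then have "E * z \<le> E * (- 1)" using z E by (intro mult_left_mono) auto
      then have "int c < 0" using c y E by linarith
      then show False by simp
    qed
    then have "E * 1 \<le> E * z" using E by (intro mult_left_mono) auto
    then have "E \<le> 2 * int c" using c y E by linarith
    then have "2 ^ expo r \<le> 2 * c" unfolding E_def by (metis of_nat_le_iff of_nat_mult of_nat_numeral of_nat_power)
    then show ?thesis using tau by linarith
  qed
  then show ?thesis using upper by simp
qed

text \<open>Three kinds of solutions: those in early runs are bounded in number; \<open>c\<close>
  determines the later run of the generic ones, and there either index determines the other; if the
  leading powers cancel, \<open>c\<close> fixes the offset, hence one residue class modulo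
  \<open>2 ^ g m\<close> in one scale \<open>m\<close>. Only \<open>m\<close> depends on
  \<open>c\<close>, never \<open>C\<close>.\<close>

lemma L_count_run_seq:
  assumes ab: "1 \<le> a" "1 \<le> b" "a \<noteq> b"
  shows "\<exists>C. \<forall>N c. \<exists>m. L_count run_seq N a b c \<le> C + 2 * d * (min N (P (Suc m)) div 2 ^ g m + 1)"
proof -
  define R where "R = P (4 * max a b)"
  define C where "C = (2 * d * R)\<^sup>2 + 4 * d"
  have "\<exists>m. L_count run_seq N a b c \<le> C + 2 * d * (min N (P (Suc m)) div 2 ^ g m + 1)" for N c
  proof -
    define S where "S = {(k, l). k \<in> {1..N} \<and> l \<in> {1..N} \<and> int a * int (run_seq k) - int b * int (run_seq l) = int c}"
    define S1 where "S1 = {(k, l) \<in> S. run_of k = run_of l \<and> (int a - int b) * int (off (run_of k)) = int c}"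
    define S2 where "S2 = {(k, l) \<in> S - S1. max (run_of k) (run_of l) < R}"
    define S3 where "S3 = {(k, l) \<in> S - S1. R \<le> max (run_of k) (run_of l)}"
    have "S \<subseteq> {1..N} \<times> {1..N}" by (auto simp: S_def)
    then have fS: "finite S" by (rule finite_subset) simp
    have S_eq: "S = S1 \<union> (S2 \<union> S3)" by (auto simp: S1_def S2_def S3_def)
    have inj1: "inj_on fst S"
    proof (rule inj_onI, clarify)
      fix k l k' l' assume *: "(k, l) \<in> S" "(k', l') \<in> S" "fst (k, l) = fst (k', l')"
      then have "int a * int (run_seq k) - int b * int (run_seq l) = int a * int (run_seq k) - int b * int (run_seq l')"
        unfolding S_def by simp
      then have "int b * int (run_seq l) = int b * int (run_seq l')" by linarith
      then have "run_seq l = run_seq l'" using ab by simp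
      then show "k = k' \<and> l = l'" using * inj_onD[OF run_seq_inj, of l l'] by (auto simp: S_def)
    qed
    have inj2: "inj_on snd S"
    proof (rule inj_onI, clarify)
      fix k l k' l' assume *: "(k, l) \<in> S" "(k', l') \<in> S" "snd (k, l) = snd (k', l')"
      then have "int a * int (run_seq k) - int b * int (run_seq l) = int a * int (run_seq k') - int b * int (run_seq l)"
        unfolding S_def by simp
      then have "int a * int (run_seq k) = int a * int (run_seq k')" by linarith
      then have "run_seq k = run_seq k'" using ab by simp
      then show "k = k' \<and> l = l'" using * inj_onD[OF run_seq_inj, of k k'] by (auto simp: S_def)
    qed
    have by_run1: "card {p \<in> S. run_of (fst p) = r} \<le> 2 * d" for r
    proof -
      have "card {p \<in> S. run_of (fst p) = r} \<le> card {k. 1 \<le> k \<and> run_of k = r}"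
        using inj1 card_run_of(2)[of r]
        by (intro card_inj_on_le[of fst]) (auto intro: inj_on_subset simp: S_def)
      then show ?thesis using card_run_of(1)[of r] by linarith
    qed
    have by_run2: "card {p \<in> S. run_of (snd p) = r} \<le> 2 * d" for r
    proof -
      have "card {p \<in> S. run_of (snd p) = r} \<le> card {k. 1 \<le> k \<and> run_of k = r}"
        using inj2 card_run_of(2)[of r]
        by (intro card_inj_on_le[of snd]) (auto intro: inj_on_subset simp: S_def)
      then show ?thesis using card_run_of(1)[of r] by linarith
    qed
    have "card S3 \<le> 4 * d"
    proof (cases "S3 = {}")
      case False
      have rng: "2 ^ \<tau> (max (run_of k) (run_of l)) \<le> c \<and> c < 2 ^ \<tau> (Suc (max (run_of k) (run_of l)))"
        if "(k, l) \<in> S3" for k l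
        using that by (intro resonance_range[OF ab(1,2), of k l c]) (auto simp: S3_def S_def S1_def R_def)
      obtain k0 l0 where kl0: "(k0, l0) \<in> S3" using False by auto
      define r where "r = max (run_of k0) (run_of l0)"
      have "max (run_of k) (run_of l) = r" if "(k, l) \<in> S3" for k l
      proof -
        define u where "u = max (run_of k) (run_of l)"
        \<comment> \<open>\<open>c\<close> lies in the intervals belonging to \<open>u\<close> and
          to \<open>r\<close>, which are disjoint for different runs.\<close>
        have *: "2 ^ \<tau> u \<le> c" "c < 2 ^ \<tau> (Suc u)" "2 ^ \<tau> r \<le> c" "c < 2 ^ \<tau> (Suc r)"
          using rng[OF that] rng[OF kl0] by (auto simp: u_def r_def)
        have "(2::nat) ^ \<tau> u < 2 ^ \<tau> (Suc r)" "(2::nat) ^ \<tau> r < 2 ^ \<tau> (Suc u)" using * by linarith+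
        then have "\<tau> u < \<tau> (Suc r)" "\<tau> r < \<tau> (Suc u)" by simp_all
        then have "\<not> Suc r \<le> u" "\<not> Suc u \<le> r" using \<tau>_mono by (meson leD)+
        then show ?thesis unfolding u_def[symmetric] by linarith
      qed
      then have "S3 \<subseteq> {p \<in> S. run_of (fst p) = r} \<union> {p \<in> S. run_of (snd p) = r}"
        by (fastforce simp: S3_def max_def split: if_splits)
      then have "card S3 \<le> card ({p \<in> S. run_of (fst p) = r} \<union> {p \<in> S. run_of (snd p) = r})"
        using fS by (intro card_mono) auto
      also have "\<dots> \<le> card {p \<in> S. run_of (fst p) = r} + card {p \<in> S. run_of (snd p) = r}"
        by (rule card_Un_le)
      finally show ?thesis using by_run1[of r] by_run2[of r] by linarith
    qed simp
    moreover have "card S2 \<le> (2 * d * R)\<^sup>2"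
    proof -
      have "k \<le> 2 * d * R" if "run_of k < R" for k
      proof -
        have "k - 1 = 2 * d * run_of k + (k - 1) mod (2 * d)" unfolding run_of_def by simp
        also have "\<dots> < 2 * d * Suc (run_of k)" using mod_less[of k] by simp
        also have "\<dots> \<le> 2 * d * R" using that by (intro mult_le_mono2) simp
        finally show ?thesis by simp
      qed
      then have "S2 \<subseteq> {1..2 * d * R} \<times> {1..2 * d * R}" by (auto simp: S2_def S_def)
      then have "card S2 \<le> card ({1..2 * d * R} \<times> {1..2 * d * R})" by (intro card_mono) auto
      then show ?thesis by (simp add: card_cartesian_product power2_eq_square)
    qed
    moreover have "\<exists>m. card S1 \<le> 2 * d * (min N (P (Suc m)) div 2 ^ g m + 1)"
    proof (cases "S1 = {}")
      case False
      then obtain k0 l0 where kl0: "(k0, l0) \<in> S1" by auto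
      define r0 m where "r0 = run_of k0" and "m = scale r0"
      define Q where "Q = {r. r < min N (P (Suc m)) \<and> r mod 2 ^ g m = r0 mod 2 ^ g m}"
      have inQ: "run_of k \<in> Q" if "(k, l) \<in> S1" for k l
      proof -
        have "(int a - int b) * int (off r0) = (int a - int b) * int (off (run_of k))"
        proof (rule trans)
          show "(int a - int b) * int (off r0) = int c" using kl0 by (auto simp: S1_def r0_def)
          show "int c = (int a - int b) * int (off (run_of k))" using that by (auto simp: S1_def)
        qed
        then have "off r0 = off (run_of k)" using ab by simp
        from off_eq_imp[OF this] have "scale (run_of k) = m" "run_of k mod 2 ^ g m = r0 mod 2 ^ g m"
          by (auto simp: m_def)
        moreover have "run_of k < N" using that run_of_le[of k] by (auto simp: S1_def S_def)
        ultimately show ?thesis using scale_bounds(2)[of "run_of k"] by (simp add: Q_def)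
      qed
      have "S1 \<subseteq> (\<Union>r\<in>Q. {p \<in> S. run_of (fst p) = r})"
      proof
        fix p assume p: "p \<in> S1"
        then have "run_of (fst p) \<in> Q" using inQ[of "fst p" "snd p"] by simp
        moreover have "p \<in> S" using p by (auto simp: S1_def)
        ultimately show "p \<in> (\<Union>r\<in>Q. {p \<in> S. run_of (fst p) = r})" by blast
      qed
      then have "card S1 \<le> card (\<Union>r\<in>Q. {p \<in> S. run_of (fst p) = r})"
        using fS by (intro card_mono) (auto simp: Q_def)
      also have "\<dots> \<le> (\<Sum>r\<in>Q. card {p \<in> S. run_of (fst p) = r})" by (rule card_UN_le) (simp add: Q_def)
      also have "\<dots> \<le> (\<Sum>r\<in>Q. 2 * d)" by (intro sum_mono by_run1)
      also have "\<dots> = 2 * d * card Q" by simp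
      also have "\<dots> \<le> 2 * d * (min N (P (Suc m)) div 2 ^ g m + 1)"
        unfolding Q_def by (intro mult_le_mono2 card_residue_class_le) simp
      finally show ?thesis by blast
    qed auto
    moreover have "card S \<le> card S1 + (card S2 + card S3)"
      unfolding S_eq by (rule order_trans[OF card_Un_le]) (intro add_left_mono card_Un_le)
    moreover have "L_count run_seq N a b c = card S" by (simp only: L_count_def S_def)
    ultimately obtain m where "card S1 \<le> 2 * d * (min N (P (Suc m)) div 2 ^ g m + 1)" "card S \<le> card S1 + (card S2 + card S3)"
      "card S3 \<le> 4 * d" "card S2 \<le> (2 * d * R)\<^sup>2" "L_count run_seq N a b c = card S" by blast
    then have "L_count run_seq N a b c \<le> C + 2 * d * (min N (P (Suc m)) div 2 ^ g m + 1)" unfolding C_def by linarith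
    then show ?thesis by blast
  qed
  then show ?thesis by blast
qed

end

section \<open>The law of the iterated logarithm along runs\<close>

definition dyadic_cos :: "nat \<Rightarrow> real \<Rightarrow> real" where
  "dyadic_cos d x = (\<Sum>j<d. cos (2 * pi * 2 ^ j * x))"

lemma trig_poly_dyadic_cos: "trig_poly (dyadic_cos d)"
  unfolding trig_poly_def
proof (intro exI allI)
  fix x :: real
  define A where "A = (\<lambda>i::nat. 2 ^ i :: nat) ` {..<d}"
  have A: "A \<subseteq> {..2 ^ d}" by (auto simp: A_def)
  have inj: "inj_on (\<lambda>i::nat. 2 ^ i :: nat) {..<d}" by (auto simp: inj_on_def)
  have "(\<Sum>j\<le>2 ^ d. (if j \<in> A then 1 else 0) * cos (2 * pi * real j * x) + 0 * sin (2 * pi * real j * x))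
     = (\<Sum>j\<in>A. cos (2 * pi * real j * x))"
    using A by (intro sum.mono_neutral_cong_right) auto
  also have "\<dots> = dyadic_cos d x"
    unfolding A_def by (subst sum.reindex[OF inj]) (simp add: dyadic_cos_def)
  finally show "dyadic_cos d x = (\<Sum>j\<le>2 ^ d. (if j \<in> A then 1 else 0) * cos (2 * pi * real j * x) + 0 * sin (2 * pi * real j * x))"
    by simp
qed

lemma mean_zero_dyadic_cos: "mean_zero (dyadic_cos d)"
proof -
  have "tpoly {j. j \<noteq> 0} (\<lambda>x. \<Sum>j<d. cos (2 * pi * of_int (2 ^ j) * x + 0))"
    by (intro tpoly_sum tpoly.cos) simp
  moreover have "(\<lambda>x. \<Sum>j<d. cos (2 * pi * of_int (2 ^ j) * x + 0)) = dyadic_cos d"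
    by (auto simp: dyadic_cos_def)
  ultimately have "tpoly {j. j \<noteq> 0} (dyadic_cos d)" by (simp only:)
  then show ?thesis unfolding mean_zero_def by (rule tpoly_integral_0) simp
qed

lemma dyadic_cos_neq_0: "0 < d \<Longrightarrow> dyadic_cos d \<noteq> (\<lambda>x. 0)"
proof
  assume "0 < d" "dyadic_cos d = (\<lambda>x. 0)"
  then have "dyadic_cos d 0 = 0" by simp
  then show False using \<open>0 < d\<close> by (simp add: dyadic_cos_def)
qed

lemma has_integral_cos_sum_square:
  fixes a :: "'a \<Rightarrow> int"
  assumes "finite I" "inj_on a I" "\<And>i. i \<in> I \<Longrightarrow> 0 < a i"
  shows "((\<lambda>x. (\<Sum>i\<in>I. cos (2 * pi * of_int (a i) * x))\<^sup>2) has_integral real (card I) / 2) {0..1}"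
proof -
  have "((\<lambda>x. \<Sum>i\<in>I. \<Sum>j\<in>I. cos (2 * pi * of_int (a i) * x + 0) * cos (2 * pi * of_int (a j) * x + 0)) has_integral
     (\<Sum>i\<in>I. \<Sum>j\<in>I. if a i = a j then cos (0 - 0) / 2 else 0)) {0..1}"
    using assms by (intro has_integral_sum integral_cos_mult_cos) auto
  also have "(\<lambda>x. \<Sum>i\<in>I. \<Sum>j\<in>I. cos (2 * pi * of_int (a i) * x + 0) * cos (2 * pi * of_int (a j) * x + 0))
    = (\<lambda>x. (\<Sum>i\<in>I. cos (2 * pi * of_int (a i) * x))\<^sup>2)"
    by (simp add: power2_eq_square sum_product)
  also have "(\<Sum>i\<in>I. \<Sum>j\<in>I. if a i = a j then cos (0 - 0) / 2 else 0) = (\<Sum>i\<in>I. \<Sum>j\<in>I. if i = j then 1 / 2 else 0 :: real)"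
    using assms(2) by (intro sum.cong) (auto simp: inj_on_def)
  also have "\<dots> = real (card I) / 2" using assms(1) by simp
  finally show ?thesis .
qed

lemma norm_2_dyadic_cos: "norm_2 (dyadic_cos d) = sqrt (real d / 2)"
proof -
  have "((\<lambda>x. (\<Sum>j\<in>{..<d}. cos (2 * pi * of_int (2 ^ j) * x))\<^sup>2) has_integral real (card {..<d}) / 2) {0..1}"
    by (rule has_integral_cos_sum_square) (auto simp: inj_on_def)
  then have "((\<lambda>x. (dyadic_cos d x)\<^sup>2) has_integral real d / 2) {0..1}"
    by (simp add: dyadic_cos_def)
  then show ?thesis unfolding norm_2_def by (simp add: integral_unique)
qed

text \<open>For each fixed \<open>j\<close> the cosines are orthogonal. Cauchy--Schwarz over the
  \<open>d\<close> layers loses a factor \<open>d\<close>, which is harmless because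
  \<open>d\<close> is fixed.\<close>

lemma dyadic_cos_sum_second_moment:
  fixes n :: "nat \<Rightarrow> nat"
  assumes n: "inj_on n {1..N}" "\<And>k. k \<in> {1..N} \<Longrightarrow> 0 < n k"
  shows "integral {0..1} (\<lambda>x. (\<Sum>k=1..N. dyadic_cos d (real (n k) * x))\<^sup>2) \<le> real d ^ 2 * real N / 2"
proof -
  define Y where "Y j x = (\<Sum>k=1..N. cos (2 * pi * of_int (2 ^ j * int (n k)) * x))" for j :: nat and x
  have Y2: "((\<lambda>x. (Y j x)\<^sup>2) has_integral real N / 2) {0..1}" for j
  proof -
    have inj: "inj_on (\<lambda>k. 2 ^ j * int (n k)) {1..N}"
      by (rule inj_onI, rule inj_onD[OF n(1)]) simp_all
    have "((\<lambda>x. (Y j x)\<^sup>2) has_integral real (card {1..N}) / 2) {0..1}"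
      unfolding Y_def by (rule has_integral_cos_sum_square[OF _ inj]) (use n(2) in simp_all)
    then show ?thesis by simp
  qed
  have eq: "(\<Sum>k=1..N. dyadic_cos d (real (n k) * x)) = (\<Sum>j<d. Y j x)" for x
    unfolding Y_def dyadic_cos_def by (subst sum.swap) (simp add: mult_ac)
  have cs: "(\<Sum>j<d. Y j x)\<^sup>2 \<le> real d * (\<Sum>j<d. (Y j x)\<^sup>2)" for x
    using Cauchy_Schwarz_ineq_sum[of "\<lambda>j. 1" "\<lambda>j. Y j x" "{..<d}"] by simp
  have "integral {0..1} (\<lambda>x. (\<Sum>j<d. Y j x)\<^sup>2) \<le> real d * (\<Sum>j<d. real N / 2)"
  proof (rule has_integral_le)
    show "((\<lambda>x. (\<Sum>j<d. Y j x)\<^sup>2) has_integral integral {0..1} (\<lambda>x. (\<Sum>j<d. Y j x)\<^sup>2)) {0..1}"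
      unfolding Y_def by (intro integrable_integral integrable_continuous_interval continuous_intros)
    show "((\<lambda>x. real d * (\<Sum>j<d. (Y j x)\<^sup>2)) has_integral real d * (\<Sum>j<d. real N / 2)) {0..1}"
      using Y2 by (intro has_integral_mult_right has_integral_sum) auto
  qed (rule cs)
  then show ?thesis unfolding eq by (simp add: power2_eq_square)
qed

lemma chebyshev_unit_interval:
  fixes h :: "real \<Rightarrow> real"
  assumes c: "continuous_on {0..1} h"
  shows "V * measure lebesgue {x \<in> {0..1}. V \<le> (h x)\<^sup>2} \<le> integral {0..1} (\<lambda>x. (h x)\<^sup>2)"
    and "{x \<in> {0..1}. V \<le> (h x)\<^sup>2} \<in> lmeasurable"
proof -
  define S where "S = {x \<in> {0..1}. V \<le> (h x)\<^sup>2}"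
  have "compact S"
    unfolding S_def by (intro compact_superlevel continuous_intros c)
  then have S: "S \<in> lmeasurable" by (rule lmeasurable_compact)
  then show "{x \<in> {0..1}. V \<le> (h x)\<^sup>2} \<in> lmeasurable" unfolding S_def .
  have "(indicat_real S has_integral measure lebesgue S) UNIV" using lmeasurable_iff_has_integral S by blast
  then have "((\<lambda>x. if x \<in> {0..1} then indicat_real S x else 0) has_integral measure lebesgue S) UNIV"
    by (rule has_integral_eq[rotated]) (auto simp: S_def indicator_def)
  then have "(indicat_real S has_integral measure lebesgue S) {0..1}"
    by (simp only: has_integral_restrict_UNIV)
  then have "((\<lambda>x. V * indicat_real S x) has_integral V * measure lebesgue S) {0..1}"
    by (rule has_integral_mult_right)
  moreover have "((\<lambda>x. (h x)\<^sup>2) has_integral integral {0..1} (\<lambda>x. (h x)\<^sup>2)) {0..1}"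
    by (intro integrable_integral integrable_continuous_interval continuous_intros c)
  ultimately have "V * measure lebesgue S \<le> integral {0..1} (\<lambda>x. (h x)\<^sup>2)"
    by (rule has_integral_le) (auto simp: S_def indicator_def)
  then show "V * measure lebesgue {x \<in> {0..1}. V \<le> (h x)\<^sup>2} \<le> integral {0..1} (\<lambda>x. (h x)\<^sup>2)" unfolding S_def .
qed

lemma le_limsup_if_frequently:
  fixes u :: "nat \<Rightarrow> ereal"
  assumes "\<exists>\<^sub>F n in sequentially. c \<le> u n" shows "c \<le> limsup u"
proof (rule ccontr)
  assume "\<not> c \<le> limsup u"
  then have "\<forall>\<^sub>F n in sequentially. u n < c" by (intro Limsup_lessD) simp
  then show False using assms by (auto simp: frequently_def elim!: notE eventually_mono)
qed

context run_sequence
begin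

lemma sum_dyadic_cos_run_seq:
  "(\<Sum>k=1..2 * d * n. dyadic_cos d (real (run_seq k) * x)) = (\<Sum>r<n. block_sum d (expo r) (off r) x)"
proof (induction n)
  case (Suc n)
  have "{1..2 * d * Suc n} = {1..2 * d * n} \<union> {Suc (2 * d * n)..2 * d * Suc n}" by auto
  then have "(\<Sum>k=1..2 * d * Suc n. dyadic_cos d (real (run_seq k) * x)) =
    (\<Sum>k=1..2 * d * n. dyadic_cos d (real (run_seq k) * x))
     + (\<Sum>k\<in>{Suc (2 * d * n)..2 * d * Suc n}. dyadic_cos d (real (run_seq k) * x))"
    by (simp only:) (rule sum.union_disjoint, auto)
  also have "(\<Sum>k\<in>{Suc (2 * d * n)..2 * d * Suc n}. dyadic_cos d (real (run_seq k) * x))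
     = (\<Sum>s<2 * d. dyadic_cos d (real (run_seq (Suc (2 * d * n + s))) * x))"
    by (rule sum.reindex_bij_witness[of _ "\<lambda>s. Suc (2 * d * n + s)" "\<lambda>k. k - Suc (2 * d * n)"]) auto
  also have "\<dots> = (\<Sum>s<2 * d. \<Sum>j<d. cos (2 * pi * 2 ^ j * ((2 ^ (expo n + s) + real (off n)) * x)))"
  proof (rule sum.cong[OF refl])
    fix s assume "s \<in> {..<2 * d}"
    then have "s < 2 * d" by simp
    from run_of_index[OF this, of n]
    have "run_seq (Suc (2 * d * n + s)) = 2 ^ (expo n + s) + off n" unfolding run_seq_eq by simp
    then show "dyadic_cos d (real (run_seq (Suc (2 * d * n + s))) * x) = (\<Sum>j<d. cos (2 * pi * 2 ^ j * ((2 ^ (expo n + s) + real (off n)) * x)))"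
      unfolding dyadic_cos_def by simp
  qed
  also have "\<dots> = block_sum d (expo n) (off n) x"
    unfolding block_sum_def sum.cartesian_product by (rule sum.cong) auto
  finally show ?case using Suc by simp
qed simp

text \<open>The limsup is tested along \<open>N = 2 d P (m + 1)\<close>. The term
  \<open>sqrt N\<close> in \<open>big\<close> is the allowance for earlier scales: by Chebyshev they
  exceed it with probability at most a multiple of \<open>P m / P (m + 1)\<close>, so
  \<open>conv\<close> and the first Borel--Cantelli lemma leave finitely many exceptions.\<close>

lemma run_seq_limsup:
  assumes div: "\<not> summable (\<lambda>m. 1 / 2 ^ (g m + d + 4) * (1 / 20) ^ G m :: real)"
    and conv: "summable (\<lambda>m. real (P m) / real (P (Suc m)))"
    and big: "\<forall>\<^sub>F m in sequentially. let N = real (2 * d * P (Suc m)) in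
      0 < ln (ln N) \<and> A * sqrt (2 * N * ln (ln N)) \<le> real (G m) * (level m - 1) - sqrt N"
  shows "AE x in lebesgue_on {0..1}.
     ereal A \<le> limsup (\<lambda>N. ereal (\<bar>\<Sum>k=1..N. dyadic_cos d (real (run_seq k) * x)\<bar> / sqrt (2 * real N * ln (ln (real N)))))"
proof -
  define S where "S N x = (\<Sum>k=1..N. dyadic_cos d (real (run_seq k) * x))" for N x
  define n where "n m = 2 * d * P (Suc m)" for m
  define T where "T m = {x \<in> {0..1}. real (n m) \<le> (S (2 * d * P m) x)\<^sup>2}" for m
  have n_pos: "0 < n m" for m using P_ge[of "Suc m"] d by (simp add: n_def)
  have cont: "continuous_on {0..1} (S N)" for N
    unfolding S_def dyadic_cos_def by (intro continuous_intros)
  have T: "T m \<in> lmeasurable" for m unfolding T_def by (rule chebyshev_unit_interval(2)[OF cont])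
  have T_le: "measure lebesgue (T m) \<le> real d ^ 2 / 2 * (real (P m) / real (P (Suc m)))" for m
  proof -
    have "real (n m) * measure lebesgue (T m) \<le> integral {0..1} (\<lambda>x. (S (2 * d * P m) x)\<^sup>2)"
      unfolding T_def by (rule chebyshev_unit_interval(1)[OF cont])
    also have "\<dots> \<le> real d ^ 2 * real (2 * d * P m) / 2"
      unfolding S_def using run_seq_inj run_seq_pos
      by (intro dyadic_cos_sum_second_moment) (auto intro: inj_on_subset)
    finally have "measure lebesgue (T m) \<le> (real d ^ 2 * real (2 * d * P m) / 2) / real (n m)"
      using n_pos[of m] by (simp add: pos_le_divide_eq mult.commute)
    also have "\<dots> = real d ^ 2 / 2 * (real (P m) / real (P (Suc m)))"
      using d by (simp add: n_def)
    finally show ?thesis .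
  qed
  have sT: "summable (\<lambda>m. measure lebesgue (T m))"
    by (rule summable_comparison_test'[OF summable_mult[OF conv, of "real d ^ 2 / 2"], of 0]) (use T_le in auto)
  have nT: "limsup T \<in> null_sets lebesgue"
  proof (rule borel_cantelli_limsup1[OF _ _ sT])
    show "T m \<in> sets lebesgue" for m using T by (rule fmeasurableD)
    show "emeasure lebesgue (T m) < \<infinity>" for m
      using fmeasurableD2[OF T] unfolding infinity_ennreal_def by (simp only: less_top)
  qed
  have nX: "{x \<in> {0..<1}. finite {m. x \<in> scale_event m}} \<in> null_sets lebesgue"
    using scale_events_infinitely_often[OF div] by (simp only: negligible_iff_null_sets)
  \<comment> \<open>The events live on \<open>{0..<1}\<close>, so the endpoint 1 has to be discarded
    separately.\<close>
  have n1: "{1::real} \<in> null_sets lebesgue" by (simp flip: negligible_iff_null_sets)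
  have n_mono: "strict_mono n"
    using P_less_Suc d unfolding n_def strict_mono_Suc_iff by simp
  have main: "ereal A \<le> limsup (\<lambda>N. ereal (\<bar>S N x\<bar> / sqrt (2 * real N * ln (ln (real N)))))"
    if x: "x \<in> {0..1}" "x \<noteq> 1" "x \<notin> limsup T" "x \<notin> {x \<in> {0..<1}. finite {m. x \<in> scale_event m}}" for x
  proof (rule le_limsup_if_frequently)
    have "infinite {m. x \<in> scale_event m}" using x by auto
    then have "\<exists>\<^sub>F m in sequentially. x \<in> scale_event m"
      unfolding frequently_cofinite[symmetric] cofinite_eq_sequentially .
    moreover have "\<forall>\<^sub>F m in sequentially. x \<notin> T m"
      using x(3) by (simp add: mem_limsup_iff not_frequently)
    moreover note big
    ultimately have "\<exists>\<^sub>F m in sequentially. x \<in> scale_event m \<and> x \<notin> T m \<and>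
       (let N = real (n m) in 0 < ln (ln N) \<and> A * sqrt (2 * N * ln (ln N)) \<le> real (G m) * (level m - 1) - sqrt N)"
      unfolding n_def by (rule frequently_eventually_frequently[OF _ eventually_conj])
    then have "\<exists>\<^sub>F m in sequentially. ereal A \<le> ereal (\<bar>S (n m) x\<bar> / sqrt (2 * real (n m) * ln (ln (real (n m)))))"
    proof (rule frequently_elim1)
      fix m assume *: "x \<in> scale_event m \<and> x \<notin> T m \<and>
       (let N = real (n m) in 0 < ln (ln N) \<and> A * sqrt (2 * N * ln (ln N)) \<le> real (G m) * (level m - 1) - sqrt N)"
      have split: "{..<P (Suc m)} = {..<P m} \<union> {P m..<P (Suc m)}" using P_less_Suc[of m] by auto
      have "S (n m) x = (\<Sum>r<P (Suc m). block_sum d (expo r) (off r) x)"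
        unfolding S_def n_def by (rule sum_dyadic_cos_run_seq)
      also have "\<dots> = (\<Sum>r<P m. block_sum d (expo r) (off r) x) + (\<Sum>r\<in>{P m..<P (Suc m)}. block_sum d (expo r) (off r) x)"
        unfolding split by (rule sum.union_disjoint) auto
      also have "(\<Sum>r<P m. block_sum d (expo r) (off r) x) = S (2 * d * P m) x"
        unfolding S_def by (rule sum_dyadic_cos_run_seq[symmetric])
      finally have s: "S (n m) x = S (2 * d * P m) x + (\<Sum>r\<in>{P m..<P (Suc m)}. block_sum d (expo r) (off r) x)" .
      have "(S (2 * d * P m) x)\<^sup>2 < real (n m)" using * x(1) by (auto simp: T_def)
      then have "\<bar>S (2 * d * P m) x\<bar> \<le> sqrt (real (n m))"
        by (metis less_imp_le real_sqrt_abs real_sqrt_le_iff)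
      moreover have "real (G m) * (level m - 1) \<le> (\<Sum>r\<in>{P m..<P (Suc m)}. block_sum d (expo r) (off r) x)"
        using * by (intro scale_event_lower) simp
      moreover have b: "0 < ln (ln (real (n m)))"
        "A * sqrt (2 * real (n m) * ln (ln (real (n m)))) \<le> real (G m) * (level m - 1) - sqrt (real (n m))"
        using * by (simp_all only: Let_def)
      ultimately have "A * sqrt (2 * real (n m) * ln (ln (real (n m)))) \<le> \<bar>S (n m) x\<bar>"
        using s by linarith
      moreover have "0 < sqrt (2 * real (n m) * ln (ln (real (n m))))" using b(1) n_pos[of m] by simp
      ultimately show "ereal A \<le> ereal (\<bar>S (n m) x\<bar> / sqrt (2 * real (n m) * ln (ln (real (n m)))))"
        by (simp only: ereal_less_eq pos_le_divide_eq)
    qed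
    then show "\<exists>\<^sub>F N in sequentially. ereal A \<le> ereal (\<bar>S N x\<bar> / sqrt (2 * real N * ln (ln (real N))))"
      using filterlim_subseq[OF n_mono] unfolding frequently_def filterlim_iff by blast
  qed
  have "AE x in lebesgue. x \<in> {0..1} \<longrightarrow> ereal A \<le> limsup (\<lambda>N. ereal (\<bar>S N x\<bar> / sqrt (2 * real N * ln (ln (real N)))))"
    using AE_not_in[OF nT] AE_not_in[OF nX] AE_not_in[OF n1] by eventually_elim (use main in blast)
  then show ?thesis
    unfolding S_def by (subst AE_restrict_space_iff) simp_all
qed

end

section \<open>Choice of parameters\<close>

text \<open>
  The number of groups is chosen such that \<open>G m \<ge> 2304 (K + 1)\<^sup>2 / d * ln (ln N)\<close> at the end of scale \<open>m\<close>,
  which is what the target deviation requires; \<open>d\<close> is then so large that \<open>(1/20) ^ G m\<close> is at least of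
  order \<open>m powr (- \<epsilon> / 2)\<close>. Together with the probability \<open>m powr (\<epsilon> / 2 - 1)\<close> of the initial block of
  zero digits this gives the divergent series \<open>1 / m\<close>.
\<close>

locale run_parameters =
  fixes \<epsilon> K :: real
  assumes eps: "0 < \<epsilon>" "\<epsilon> < 1" and K: "0 < K"
begin

text \<open>\<open>55296 = 12 * 4608\<close> yields \<open>12 \<kappa> \<le> \<epsilon>\<close>.
  This is what \<open>(1/20) ^ G m\<close> needs, since \<open>20 \<le> exp 6\<close> and
  \<open>6 \<kappa> \<le> \<epsilon> / 2\<close>.\<close>

definition d :: nat where "d = nat \<lceil>55296 * (K + 1)\<^sup>2 / \<epsilon>\<rceil> + 2"

text \<open>\<open>4608 = 2 * 2304\<close>: the 2 comes from
  \<open>ln (ln N) \<le> 2 ln (m + 1)\<close>, and \<open>2304 = 4 * 24^2\<close> from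
  \<open>N \<le> 4 d G B\<close> and the level \<open>sqrt (B d^3) / 24\<close> reached by each
  group.\<close>

definition \<kappa> :: real where "\<kappa> = 4608 * (K + 1)\<^sup>2 / real d"

definition G :: "nat \<Rightarrow> nat" where "G m = nat \<lfloor>\<kappa> * ln (real (Suc m))\<rfloor> + 1"

text \<open>The squared factorial makes \<open>P m / P (m + 1)\<close> of order
  \<open>1 / m^2\<close>. The constant \<open>2304 = 48^2\<close> lets half of
  \<open>sqrt (B d^3) / 12\<close> absorb the two lost units; \<open>d^2\<close> serves the fourth
  moment bound.\<close>

definition B :: "nat \<Rightarrow> nat" where "B m = 2304 * d\<^sup>2 * (fact (Suc m))\<^sup>2"

definition g :: "nat \<Rightarrow> nat" where "g m = nat \<lfloor>(1 - \<epsilon> / 2) * log 2 (real (Suc m))\<rfloor>"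

sublocale run_sequence d G B g
proof
  show "2 \<le> d" by (simp add: d_def)
  show "2304 * d\<^sup>2 \<le> B m" for m
    using mult_le_mono2[of 1 "(fact (Suc m))\<^sup>2" "2304 * d\<^sup>2"] unfolding B_def by (simp del: fact_Suc)
  show "1 \<le> G m" for m by (simp add: G_def)
qed

lemma kappa: "0 < \<kappa>" "12 * \<kappa> \<le> \<epsilon>"
proof -
  have d0: "0 < real d" using d by simp
  show "0 < \<kappa>" using K d0 by (simp add: \<kappa>_def)
  have "55296 * (K + 1)\<^sup>2 / \<epsilon> \<le> real d" unfolding d_def by linarith
  then have "55296 * (K + 1)\<^sup>2 \<le> \<epsilon> * real d" using eps by (simp add: divide_le_eq mult.commute)
  then show "12 * \<kappa> \<le> \<epsilon>" using d0 by (simp add: \<kappa>_def divide_le_eq)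
qed

lemma G_bounds: "\<kappa> * ln (real (Suc m)) \<le> real (G m)" "real (G m) \<le> \<kappa> * ln (real (Suc m)) + 1"
proof -
  have "0 \<le> \<kappa> * ln (real (Suc m))" using kappa by (intro mult_nonneg_nonneg) auto
  then show "\<kappa> * ln (real (Suc m)) \<le> real (G m)" "real (G m) \<le> \<kappa> * ln (real (Suc m)) + 1"
    unfolding G_def by linarith+
qed

lemma two_power_g:
  "2 ^ g m \<le> real (Suc m) powr (1 - \<epsilon> / 2)" "real (Suc m) powr (1 - \<epsilon> / 2) \<le> 2 * 2 ^ g m"
proof -
  define y where "y = (1 - \<epsilon> / 2) * log 2 (real (Suc m))"
  have y: "0 \<le> y" unfolding y_def using eps by (intro mult_nonneg_nonneg) auto
  have "2 powr y = (2 powr log 2 (real (Suc m))) powr (1 - \<epsilon> / 2)" unfolding powr_powr y_def by (simp only: mult.commute)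
  then have 2: "2 powr y = real (Suc m) powr (1 - \<epsilon> / 2)" by simp
  have gy: "real (g m) \<le> y" "y \<le> real (g m) + 1" using y unfolding g_def y_def[symmetric] by linarith+
  have p: "(2::real) ^ g m = 2 powr real (g m)" by (simp add: powr_realpow)
  show "2 ^ g m \<le> real (Suc m) powr (1 - \<epsilon> / 2)" unfolding p 2[symmetric] using gy by (intro powr_mono) auto
  have "2 powr y \<le> 2 powr (real (g m) + 1)" using gy by (intro powr_mono) auto
  also have "\<dots> = 2 * 2 ^ g m" by (simp add: powr_add p)
  finally show "real (Suc m) powr (1 - \<epsilon> / 2) \<le> 2 * 2 ^ g m" unfolding 2 .
qed

lemma twentieth_power_G: "1 / 20 * real (Suc m) powr (- (\<epsilon> / 2)) \<le> (1 / 20) ^ G m"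
proof -
  define n where "n = nat \<lfloor>\<kappa> * ln (real (Suc m))\<rfloor>"
  have "20 \<le> exp (6::real)" using exp_lower_Taylor_quadratic[of "6::real"] by simp
  then have "exp (- 6) \<le> (1 / 20 :: real)" unfolding exp_minus inverse_eq_divide by (intro divide_left_mono) auto
  then have "exp (- 6) ^ n \<le> (1 / 20 :: real) ^ n" by (intro power_mono) auto
  then have 1: "exp (- (6 * real n)) \<le> (1 / 20) ^ n" by (simp add: exp_of_nat_mult[symmetric] mult.commute)
  have l: "0 \<le> ln (real (Suc m))" by simp
  have "0 \<le> \<kappa> * ln (real (Suc m))" using kappa l by (intro mult_nonneg_nonneg) auto
  then have "6 * real n \<le> 6 * (\<kappa> * ln (real (Suc m)))" unfolding n_def by linarith
  also have "\<dots> = (6 * \<kappa>) * ln (real (Suc m))" by simp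
  also have "\<dots> \<le> (\<epsilon> / 2) * ln (real (Suc m))" using kappa l by (intro mult_right_mono) auto
  finally have "exp (- ((\<epsilon> / 2) * ln (real (Suc m)))) \<le> exp (- (6 * real n))" by simp
  also note 1
  finally have "real (Suc m) powr (- (\<epsilon> / 2)) \<le> (1 / 20) ^ n" by (simp add: powr_def)
  then show ?thesis by (simp add: G_def n_def)
qed

lemma event_probabilities_diverge: "\<not> summable (\<lambda>m. 1 / 2 ^ (g m + d + 4) * (1 / 20) ^ G m :: real)"
proof
  assume s: "summable (\<lambda>m. 1 / 2 ^ (g m + d + 4) * (1 / 20) ^ G m :: real)"
  define c :: real where "c = 1 / 2 ^ (d + 4) * (1 / 20)"
  have c: "0 < c" by (simp add: c_def)
  have le: "c * inverse (real (Suc m)) \<le> 1 / 2 ^ (g m + d + 4) * (1 / 20) ^ G m" for m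
  proof -
    define x where "x = real (Suc m)"
    have x: "0 < x" by (simp add: x_def)
    have "inverse x = x powr (- (1 - \<epsilon> / 2)) * x powr (- (\<epsilon> / 2))"
      using x unfolding powr_add[symmetric] by (simp add: powr_minus)
    also have "x powr (- (1 - \<epsilon> / 2)) = 1 / x powr (1 - \<epsilon> / 2)" by (rule powr_minus_divide)
    finally have "c * inverse x = (1 / x powr (1 - \<epsilon> / 2)) * (1 / 2 ^ (d + 4)) * (1 / 20 * x powr (- (\<epsilon> / 2)))"
      by (simp add: c_def)
    also have "\<dots> \<le> (1 / 2 ^ g m) * (1 / 2 ^ (d + 4)) * (1 / 20) ^ G m"
      using two_power_g(1)[of m] twentieth_power_G[of m]
      by (intro mult_mono divide_left_mono) (auto simp: x_def)
    also have "\<dots> = 1 / 2 ^ (g m + d + 4) * (1 / 20) ^ G m" by (simp add: power_add)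
    finally show ?thesis by (simp only: x_def)
  qed
  have "summable (\<lambda>m. c * inverse (real (Suc m)))"
    by (rule summable_comparison_test'[OF s, of 0]) (use le c in simp)
  then have "summable (\<lambda>m. inverse (real (Suc m)))" using c by (simp add: summable_cmult_iff)
  then show False using not_summable_harmonic[where 'a = real] summable_Suc_iff[of "\<lambda>n. inverse (real n)"] by simp
qed

section \<open>Sizes of the scales\<close>

lemma G_mono: "G m \<le> G (Suc m)"
  unfolding G_def using kappa by (intro add_right_mono nat_mono floor_mono mult_left_mono) auto

lemma GB_growth: "(m + 2)\<^sup>2 * (G m * B m) \<le> G (Suc m) * B (Suc m)"
proof -
  have "B (Suc m) = (m + 2)\<^sup>2 * B m" 
  proof -
    have "fact (Suc (Suc m)) = (m + 2) * (fact (Suc m) :: nat)" unfolding fact_Suc[of "Suc m"] by simp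
    then show ?thesis unfolding B_def by (simp only: power_mult_distrib mult_ac)
  qed
  then have "(m + 2)\<^sup>2 * (G m * B m) = G m * B (Suc m)" by simp
  also have "\<dots> \<le> G (Suc m) * B (Suc m)" by (rule mult_le_mono1[OF G_mono])
  finally show ?thesis .
qed

text \<open>By the growth factor \<open>(m + 2)^2\<close> the last scale makes up at least half of
  the total, so \<open>N\<close> is comparable with \<open>d G B\<close>.\<close>

lemma P_Suc_le: "P (Suc m) \<le> 2 * (G m * B m)"
proof (induction m)
  case 0
  show ?case by (simp add: P_def)
next
  case (Suc m)
  have "2 * (G m * B m) \<le> (m + 2)\<^sup>2 * (G m * B m)"
    by (intro mult_le_mono1) (simp add: power2_eq_square)
  then show ?case using Suc GB_growth[of m] P_Suc[of "Suc m"] by linarith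
qed

lemma P_ratio_summable: "summable (\<lambda>m. real (P m) / real (P (Suc m)))"
proof (rule summable_comparison_test'[of "\<lambda>m. 2 * inverse (real m ^ 2)" 1])
  show "summable (\<lambda>m. 2 * inverse (real m ^ 2))" by (intro summable_mult inverse_power_summable) simp
  fix m :: nat assume "1 \<le> m"
  then obtain k where k: "m = Suc k" by (cases m) auto
  define R where "R = G k * B k"
  have R: "0 < R" using G[of k] B_pos[of k] by (simp add: R_def)
  have "real (m\<^sup>2 * R) \<le> real ((k + 2)\<^sup>2 * R)" unfolding k of_nat_le_iff by (intro mult_le_mono1 power_mono) auto
  also have "\<dots> \<le> real (P (Suc m))" unfolding of_nat_le_iff using GB_growth[of k] P_Suc[of m] by (simp add: k R_def)
  finally have u: "real m ^ 2 * real R \<le> real (P (Suc m))" by simp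
  have "real (P m) \<le> real (2 * R)" unfolding of_nat_le_iff using P_Suc_le[of k] by (simp add: k R_def)
  then have "real (P m) / real (P (Suc m)) \<le> (2 * real R) / (real m ^ 2 * real R)"
    using u R \<open>1 \<le> m\<close> by (intro frac_le) auto
  also have "\<dots> = 2 * inverse (real m ^ 2)" using R by (simp add: field_simps)
  finally show "norm (real (P m) / real (P (Suc m))) \<le> 2 * inverse (real m ^ 2)" by simp
qed

text \<open>The bound \<open>n! \<le> n^n\<close> suffices here. The factor \<open>b\<close> is
  \<open>2 d\<close> for the deviation estimate and 1 for the counting.\<close>

lemma ln_P_le:
  assumes "1 \<le> b"
  shows "\<exists>c\<ge>0. \<forall>m. ln (b * real (P (Suc m))) \<le> c + 3 * (real (Suc m) * ln (real (Suc m)))"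
proof (intro exI conjI allI)
  define a where "a = b * 4608 * real d ^ 2 * (\<kappa> + 1)"
  have "1 * 1 * 1 * 1 \<le> b * 4608 * real d ^ 2 * (\<kappa> + 1)"
    using assms d kappa by (intro mult_mono) auto
  then have a: "1 \<le> a" by (simp add: a_def)
  show "0 \<le> ln a" using a by simp
  fix m
  define x where "x = real (Suc m)"
  have x: "1 \<le> x" by (simp add: x_def)
  have f: "real (fact (Suc m)) \<le> x ^ Suc m"
    unfolding x_def using fact_le_power[of "Suc m", where 'a = real] by (simp only: of_nat_fact of_nat_power)
  have "ln x \<le> x" using x ln_le_minus_one[of x] by simp
  then have "\<kappa> * ln x + 1 \<le> \<kappa> * x + x" using x kappa by (intro add_mono mult_left_mono) auto
  then have Gx: "real (G m) \<le> (\<kappa> + 1) * x" using G_bounds(2)[of m] by (simp add: x_def algebra_simps)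
  have "real (P (Suc m)) \<le> real (2 * (G m * B m))" unfolding of_nat_le_iff by (rule P_Suc_le)
  also have "\<dots> = 4608 * real d ^ 2 * (real (G m) * (real (fact (Suc m)))\<^sup>2)"
    unfolding B_def by (simp del: fact_Suc)
  also have "\<dots> \<le> 4608 * real d ^ 2 * ((\<kappa> + 1) * x * (x ^ Suc m)\<^sup>2)"
    using Gx f kappa x by (intro mult_left_mono mult_mono power_mono) auto
  finally have "b * real (P (Suc m)) \<le> b * (4608 * real d ^ 2 * ((\<kappa> + 1) * x * (x ^ Suc m)\<^sup>2))"
    using assms by (intro mult_left_mono) auto
  also have "\<dots> = a * x ^ (2 * Suc m + 1)"
    unfolding a_def power_add power_mult by (simp add: mult_ac power_mult[symmetric] power_add[symmetric] flip: power_Suc) 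
  finally have le: "b * real (P (Suc m)) \<le> a * x ^ (2 * Suc m + 1)" .
  have "0 < P (Suc m)" using P_ge[of "Suc m"] by simp
  then have "ln (b * real (P (Suc m))) \<le> ln (a * x ^ (2 * Suc m + 1))"
    using le assms a x by (subst ln_le_cancel_iff) auto
  also have "\<dots> = ln a + real (2 * Suc m + 1) * ln x"
  proof -
    have "ln (a * x ^ n) = ln a + real n * ln x" for n using a x by (simp add: ln_mult ln_realpow)
    then show ?thesis .
  qed
  also have "\<dots> \<le> ln a + (3 * x) * ln x"
    using x by (intro add_left_mono mult_right_mono) (auto simp: x_def)
  finally show "ln (b * real (P (Suc m))) \<le> ln a + 3 * (real (Suc m) * ln (real (Suc m)))"
    by (simp only: x_def mult.assoc)
qed

text \<open>Squaring reduces the claim to \<open>2304 (K + 1)^2 ln (ln N) \<le> G d\<close>. Passing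
  from \<open>K\<close> to \<open>K + 1\<close> makes room for the \<open>sqrt N\<close> reserved
  for earlier scales.\<close>

lemma eventually_large_sum:
  defines "A \<equiv> K * norm_2 (dyadic_cos d)"
  shows "\<forall>\<^sub>F m in sequentially. let N = real (2 * d * P (Suc m)) in
      0 < ln (ln N) \<and> A * sqrt (2 * N * ln (ln N)) \<le> real (G m) * (level m - 1) - sqrt N"
proof -
  define N where "N m = real (2 * d * P (Suc m))" for m
  define x where "x m = real (Suc m)" for m
  have "1 \<le> 2 * real d" using d by simp
  then obtain c where c: "0 \<le> c" "\<And>m. ln (2 * real d * real (P (Suc m))) \<le> c + 3 * (x m * ln (x m))"
    using ln_P_le[of "2 * real d"] unfolding x_def by blast
  have xt: "filterlim x at_top sequentially"
    unfolding x_def by (rule filterlim_compose[OF filterlim_real_sequentially filterlim_Suc])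
  have "((\<lambda>m. ln (x m) / x m) \<longlongrightarrow> 0) sequentially"
    by (rule filterlim_compose[OF ln_x_over_x_tendsto_0 xt])
  then have e1: "\<forall>\<^sub>F m in sequentially. ln (x m) / x m < 1 / 6" by (rule order_tendstoD) simp
  \<comment> \<open>\<open>exp (exp 1)\<close> ensures \<open>ln (ln N) \<ge> 1\<close>. The term
    \<open>2 c\<close>, with the bound 1/6 above, gives \<open>c + 3 x ln x \<le> x^2\<close> and
    thus \<open>ln (ln N) \<le> 2 ln x\<close>.\<close>
  have e2: "\<forall>\<^sub>F m in sequentially. 2 * c + exp (exp 1) + 1 \<le> x m"
    using xt by (simp add: filterlim_at_top)
  show ?thesis unfolding N_def[symmetric] Let_def
    using e1 e2
  proof eventually_elim
    case (elim m)
    have x1: "1 \<le> x m" "0 < x m" by (simp_all add: x_def)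
    have "ln (x m) \<le> 1 / 6 * x m" using elim(1) x1 by (simp add: divide_less_eq)
    then have "x m * ln (x m) \<le> x m * (1 / 6 * x m)" using x1 by (intro mult_left_mono) auto
    moreover have "2 * c * 1 \<le> x m * x m" using elim(2) x1 c(1) exp_ge_zero[of "exp (1::real)"] by (intro mult_mono) linarith+
    moreover have "ln (N m) \<le> c + 3 * (x m * ln (x m))" using c(2)[of m] by (simp add: N_def)
    ultimately have lN: "ln (N m) \<le> (x m)\<^sup>2" by (simp add: power2_eq_square)
    have PN: "real (P (Suc m)) \<le> N m" using d by (simp add: N_def mult_le_cancel_right1)
    have "x m \<le> real (P (Suc m))" unfolding x_def of_nat_le_iff by (rule P_ge)
    then have "exp (exp 1) \<le> N m" using PN elim(2) c(1) by linarith
    then have N0: "exp (exp 1) \<le> N m" "0 < N m" by (auto intro: less_le_trans[OF exp_gt_zero])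
    then have lN1: "exp 1 \<le> ln (N m)" using ln_ge_iff by blast
    then have lN0: "0 < ln (N m)" using exp_gt_zero[of "1::real"] by linarith
    define LL where "LL = ln (ln (N m))"
    have LL1: "1 \<le> LL" unfolding LL_def using lN1 lN0 ln_ge_iff by blast
    have "LL \<le> ln ((x m)\<^sup>2)" unfolding LL_def using lN lN0 x1 by (subst ln_le_cancel_iff) auto
    then have LLx: "LL \<le> 2 * ln (x m)" using x1 by (simp add: ln_realpow)
    have d0: "2 \<le> real d" using d by simp
    have "2304 * (K + 1)\<^sup>2 * LL \<le> 2304 * (K + 1)\<^sup>2 * (2 * ln (x m))" using LLx by (intro mult_left_mono) auto
    also have "\<dots> = \<kappa> * ln (x m) * real d" using d0 by (simp add: \<kappa>_def)
    also have "\<dots> \<le> real (G m) * real d" using G_bounds(1)[of m] by (intro mult_right_mono) (auto simp: x_def)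
    finally have Gd: "2304 * (K + 1)\<^sup>2 * LL \<le> real (G m) * real d" .
    define b where "b = sqrt (real (B m) * real d ^ 3)"
    \<comment> \<open>From 48 on, \<open>b / 12 - 2 \<ge> b / 24\<close>.\<close>
    have "48 = sqrt (48\<^sup>2)" by simp
    also have "\<dots> \<le> b"
    proof -
      have "2304 * 1 * 1 \<le> real (B m) * real d ^ 3"
      proof -
        have "1 \<le> d ^ 2" using d by simp
        then have "2304 * 1 \<le> B m" using B[of m] by linarith
        then have "2304 * 1 \<le> real (B m)" by simp
        then show ?thesis using d0 by (intro mult_mono) auto
      qed
      then show ?thesis unfolding b_def by (intro real_sqrt_le_mono) simp
    qed
    finally have "b / 24 \<le> level m - 1" by (simp add: level_def b_def)
    then have l: "real (G m) * (b / 24) \<le> real (G m) * (level m - 1)" by (intro mult_left_mono) auto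
    have A: "A = K * sqrt (real d / 2)" by (simp add: A_def norm_2_dyadic_cos)
    have "A * sqrt (2 * N m * LL) = K * sqrt (real d / 2 * (2 * N m * LL))" unfolding A real_sqrt_mult by simp
    also have "real d / 2 * (2 * N m * LL) = real d * N m * LL" by simp
    finally have A': "A * sqrt (2 * N m * LL) = K * sqrt (real d * N m * LL)" .
    have "N m * 1 \<le> N m * (real d * LL)"
      using N0 d0 LL1 mult_mono[of 1 "real d" 1 LL] by (intro mult_left_mono) auto
    then have "sqrt (N m) \<le> sqrt (real d * N m * LL)" by (intro real_sqrt_le_mono) (simp add: mult_ac)
    then have "A * sqrt (2 * N m * LL) + sqrt (N m) \<le> (K + 1) * sqrt (real d * N m * LL)"
      unfolding A' by (simp add: algebra_simps)
    also have "\<dots> = sqrt ((K + 1)\<^sup>2 * (real d * N m * LL))" using K by (simp add: real_sqrt_mult)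
    also have "\<dots> \<le> sqrt ((real (G m) * (b / 24))\<^sup>2)"
    proof (rule real_sqrt_le_mono)
      have "real (P (Suc m)) \<le> 2 * (real (G m) * real (B m))"
        using P_Suc_le[of m] by (metis of_nat_le_iff of_nat_mult of_nat_numeral)
      then have "N m \<le> 2 * real d * (2 * (real (G m) * real (B m)))" 
        unfolding N_def of_nat_mult of_nat_numeral by (rule mult_left_mono) simp
      then have "(K + 1)\<^sup>2 * (real d * N m * LL) \<le> (K + 1)\<^sup>2 * (real d * (2 * real d * (2 * (real (G m) * real (B m)))) * LL)"
        using d0 LL1 by (intro mult_left_mono mult_right_mono) auto
      also have "\<dots> = (2304 * (K + 1)\<^sup>2 * LL) * (real d ^ 2 * real (G m) * real (B m) / 576)"
        by (simp add: power2_eq_square)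
      also have "\<dots> \<le> (real (G m) * real d) * (real d ^ 2 * real (G m) * real (B m) / 576)"
        by (intro mult_right_mono Gd) auto
      also have "\<dots> = (real (G m) * (b / 24))\<^sup>2"
        by (simp add: b_def power_mult_distrib power_divide) (simp add: power2_eq_square power3_eq_cube)
      finally show "(K + 1)\<^sup>2 * (real d * N m * LL) \<le> (real (G m) * (b / 24))\<^sup>2" .
    qed
    also have "\<dots> = real (G m) * (b / 24)" by (simp add: b_def)
    also note l
    finally show ?case using LL1 by (simp add: LL_def)
  qed
qed

text \<open>\<open>ln P\<close> is of order \<open>m ln m\<close>, at most a multiple of
  \<open>m powr \<beta>\<close> for any \<open>\<beta> > 1\<close>; the choice
  \<open>\<beta> = (1 - \<epsilon>/2) / (1 - \<epsilon>)\<close> gives the exponent of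
  \<open>2 ^ g m\<close>. The factor 2 prepares for \<open>N\<close> up to
  \<open>P^2\<close>.\<close>

lemma ln_P_powr_le: "\<exists>C\<ge>0. \<forall>m. (2 * ln (real (P (Suc m)))) powr (1 - \<epsilon>) \<le> C * 2 ^ g m"
proof -
  obtain c where c: "0 \<le> c" "\<And>m. ln (1 * real (P (Suc m))) \<le> c + 3 * (real (Suc m) * ln (real (Suc m)))"
    using ln_P_le[of 1] by blast
  define \<beta> where "\<beta> = (1 - \<epsilon> / 2) / (1 - \<epsilon>)"
  have \<beta>: "1 < \<beta>" "\<beta> * (1 - \<epsilon>) = 1 - \<epsilon> / 2" using eps by (simp_all add: \<beta>_def field_simps)
  define D where "D = 2 * (c + 3 / (\<beta> - 1))"
  have D: "0 \<le> D" using c(1) \<beta> by (simp add: D_def)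
  have "(2 * ln (real (P (Suc m)))) powr (1 - \<epsilon>) \<le> (D powr (1 - \<epsilon>) * 2) * 2 ^ g m" for m
  proof -
    define x where "x = real (Suc m)"
    have x: "1 \<le> x" by (simp add: x_def)
    have "(\<beta> - 1) * ln x = ln (x powr (\<beta> - 1))" using x by (simp add: ln_powr)
    also have "\<dots> \<le> x powr (\<beta> - 1)" using ln_le_minus_one[of "x powr (\<beta> - 1)"] x by simp
    finally have "ln x \<le> x powr (\<beta> - 1) / (\<beta> - 1)" using \<beta> by (simp add: pos_le_divide_eq mult.commute)
    then have "x * ln x \<le> x * (x powr (\<beta> - 1) / (\<beta> - 1))" using x by (intro mult_left_mono) auto
    also have "\<dots> = x powr \<beta> / (\<beta> - 1)" using x by (simp add: powr_diff)
    finally have xl: "x * ln x \<le> x powr \<beta> / (\<beta> - 1)" .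
    have "1 \<le> x powr \<beta>" using x \<beta> by (intro ge_one_powr_ge_zero) auto
    then have "c * 1 \<le> c * x powr \<beta>" using c(1) by (intro mult_left_mono) auto
    then have "2 * ln (real (P (Suc m))) \<le> 2 * (c * x powr \<beta> + 3 * (x powr \<beta> / (\<beta> - 1)))"
      using c(2)[of m] xl by (simp add: x_def)
    also have "\<dots> = D * x powr \<beta>" by (simp add: D_def algebra_simps)
    finally have u: "2 * ln (real (P (Suc m))) \<le> D * x powr \<beta>" .
    have "0 \<le> 2 * ln (real (P (Suc m)))" using P_ge[of "Suc m"] by simp
    then have "(2 * ln (real (P (Suc m)))) powr (1 - \<epsilon>) \<le> (D * x powr \<beta>) powr (1 - \<epsilon>)"
      using u eps by (intro powr_mono2) auto
    also have "\<dots> = D powr (1 - \<epsilon>) * x powr (1 - \<epsilon> / 2)"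
      using D x by (simp add: powr_mult powr_powr \<beta>(2))
    also have "\<dots> \<le> D powr (1 - \<epsilon>) * (2 * 2 ^ g m)"
      using two_power_g(2)[of m] by (intro mult_left_mono) (auto simp: x_def)
    finally show ?thesis by simp
  qed
  then show ?thesis by (intro exI[of _ "D powr (1 - \<epsilon>) * 2"]) auto
qed

lemma ln_powr_le_sqrt:
  assumes "2 \<le> N" shows "(ln (real N)) powr (1 - \<epsilon>) \<le> 2 * sqrt (real N)"
proof -
  have N: "1 < real N" using assms by simp
  have l: "ln (real N) \<le> 2 * sqrt (real N)"
    using ln_le_minus_one[of "sqrt (real N)"] N by (simp add: ln_sqrt)
  show ?thesis
  proof (cases "ln (real N) \<le> 1")
    case True
    have "(ln (real N)) powr (1 - \<epsilon>) \<le> 1 powr (1 - \<epsilon>)" using True N eps by (intro powr_mono2) auto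
    moreover have "1 \<le> sqrt (real N)" using N by simp
    ultimately show ?thesis unfolding powr_one_eq_one by linarith
  next
    case False
    then have "(ln (real N)) powr (1 - \<epsilon>) \<le> (ln (real N)) powr 1" using eps by (intro powr_mono) auto
    then show ?thesis using False l by simp
  qed
qed

text \<open>The scale \<open>m\<close> selected by \<open>c\<close> need not be the scale of
  \<open>N\<close>, so the two are compared by size.\<close>

lemma L_count_bound:
  assumes "1 \<le> a" "1 \<le> b" "a \<noteq> b"
  shows "\<exists>C::real. \<forall>N\<ge>2. \<forall>c. real (L_count run_seq N a b c) \<le> C * real N / (ln (real N)) powr (1 - \<epsilon>)"
proof -
  obtain C0 where C0: "\<And>N c. \<exists>m. L_count run_seq N a b c \<le> C0 + 2 * d * (min N (P (Suc m)) div 2 ^ g m + 1)"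
    using L_count_run_seq[OF assms] by blast
  obtain C1 where C1: "0 \<le> C1" "\<And>m. (2 * ln (real (P (Suc m)))) powr (1 - \<epsilon>) \<le> C1 * 2 ^ g m"
    using ln_P_powr_le by blast
  have "real (L_count run_seq N a b c) \<le> (2 * real C0 + 2 * real d * (C1 + 4)) * real N / (ln (real N)) powr (1 - \<epsilon>)"
    if N: "2 \<le> N" for N c
  proof -
    define \<psi> where "\<psi> = real N / (ln (real N)) powr (1 - \<epsilon>)"
    have ln0: "0 < ln (real N)" using N by simp
    then have p0: "0 < (ln (real N)) powr (1 - \<epsilon>)" by simp
    have \<psi>0: "0 \<le> \<psi>" using p0 by (simp add: \<psi>_def)
    have "sqrt (real N) * (ln (real N)) powr (1 - \<epsilon>) \<le> sqrt (real N) * (2 * sqrt (real N))"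
      by (intro mult_left_mono ln_powr_le_sqrt N) simp
    also have "\<dots> = 2 * real N" by simp
    finally have sq: "sqrt (real N) \<le> 2 * \<psi>" using p0 by (simp add: \<psi>_def pos_le_divide_eq)
    have "1 \<le> sqrt (real N)" using N by simp
    then have one: "1 \<le> 2 * \<psi>" using sq by linarith
    obtain m where m: "L_count run_seq N a b c \<le> C0 + 2 * d * (min N (P (Suc m)) div 2 ^ g m + 1)"
      using C0 by blast
    have dv: "real (min N (P (Suc m)) div 2 ^ g m) \<le> real (min N (P (Suc m))) / 2 ^ g m"
      using of_nat_div_le_of_nat[of "min N (P (Suc m))" "2 ^ g m", where 'a = real] by simp
    have "real (min N (P (Suc m))) / 2 ^ g m \<le> (C1 + 2) * \<psi>"
    proof (cases "real N \<le> (real (P (Suc m)))\<^sup>2")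
      case True
      have P0: "0 < real (P (Suc m))" using P_ge[of "Suc m"] by simp
      have "ln (real N) \<le> ln ((real (P (Suc m)))\<^sup>2)" using True N P0 by (subst ln_le_cancel_iff) auto
      then have "ln (real N) \<le> 2 * ln (real (P (Suc m)))" using P0 by (simp add: ln_realpow)
      then have "(ln (real N)) powr (1 - \<epsilon>) \<le> (2 * ln (real (P (Suc m)))) powr (1 - \<epsilon>)"
        using ln0 eps by (intro powr_mono2) auto
      also have "\<dots> \<le> C1 * 2 ^ g m" by (rule C1(2))
      finally have "real N * (ln (real N)) powr (1 - \<epsilon>) \<le> real N * (C1 * 2 ^ g m)" by (intro mult_left_mono) auto
      then have "real N / 2 ^ g m \<le> C1 * \<psi>" using p0 by (simp add: \<psi>_def field_simps)
      moreover have "real (min N (P (Suc m))) / 2 ^ g m \<le> real N / 2 ^ g m" by (intro divide_right_mono) auto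
      moreover have "C1 * \<psi> \<le> (C1 + 2) * \<psi>" using \<psi>0 by (intro mult_right_mono) auto
      ultimately show ?thesis by linarith
    next
      case False
      then have "real (P (Suc m)) \<le> sqrt (real N)" by (intro real_le_rsqrt) simp
      moreover have "real (min N (P (Suc m))) / 2 ^ g m \<le> real (P (Suc m)) / 1" by (intro frac_le) auto
      moreover have "2 * \<psi> \<le> (C1 + 2) * \<psi>" using \<psi>0 C1(1) by (intro mult_right_mono) auto
      ultimately show ?thesis using sq by linarith
    qed
    then have "real (min N (P (Suc m)) div 2 ^ g m) + 1 \<le> (C1 + 4) * \<psi>"
      using dv one by (simp add: algebra_simps)
    then have "2 * real d * (real (min N (P (Suc m)) div 2 ^ g m) + 1) \<le> 2 * real d * ((C1 + 4) * \<psi>)"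
      by (intro mult_left_mono) auto
    moreover have "real C0 * 1 \<le> real C0 * (2 * \<psi>)" using one by (intro mult_left_mono) auto
    moreover have "real (L_count run_seq N a b c) \<le> real C0 + 2 * real d * (real (min N (P (Suc m)) div 2 ^ g m) + 1)"
      using of_nat_mono[OF m, where 'a = real] by (simp add: algebra_simps)
    ultimately have "real (L_count run_seq N a b c) \<le> (2 * real C0 + 2 * real d * (C1 + 4)) * \<psi>"
      by (simp add: algebra_simps)
    then show ?thesis by (simp add: \<psi>_def)
  qed
  then show ?thesis by blast
qed

end

theorem theorem1:
  fixes \<epsilon> K :: real
  assumes "0 < \<epsilon>" and "\<epsilon> < 1" and "0 < K"
  shows "\<exists>(f :: real \<Rightarrow> real) (n :: nat \<Rightarrow> nat).
           trig_poly f \<and> mean_zero f \<and> f \<noteq> (\<lambda>x. 0) \<and> lacunary n \<and>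
           (\<forall>a b :: nat. a \<ge> 1 \<longrightarrow> b \<ge> 1 \<longrightarrow> a \<noteq> b \<longrightarrow>
              (\<exists>C :: real. \<forall>N :: nat. N \<ge> 2 \<longrightarrow>
                 (\<forall>c :: nat. real (L_count n N a b c) \<le> C * real N / (ln (real N)) powr (1 - \<epsilon>)))) \<and>
           (AE x in lebesgue_on {0..1}.
              limsup (\<lambda>N. ereal (\<bar>\<Sum>k=1..N. f (real (n k) * x)\<bar> /
                                   sqrt (2 * real N * ln (ln (real N)))))
                \<ge> ereal (K * norm_2 f))"
proof -
  interpret run_parameters \<epsilon> K using assms by unfold_locales
  show ?thesis
  proof (intro exI conjI)
    show "trig_poly (dyadic_cos d)" by (rule trig_poly_dyadic_cos)
    show "mean_zero (dyadic_cos d)" by (rule mean_zero_dyadic_cos)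
    show "dyadic_cos d \<noteq> (\<lambda>x. 0)" using d by (intro dyadic_cos_neq_0) simp
    show "lacunary run_seq" by (rule lacunary_run_seq)
    show "\<forall>a b :: nat. a \<ge> 1 \<longrightarrow> b \<ge> 1 \<longrightarrow> a \<noteq> b \<longrightarrow>
        (\<exists>C :: real. \<forall>N :: nat. N \<ge> 2 \<longrightarrow>
          (\<forall>c :: nat. real (L_count run_seq N a b c) \<le> C * real N / (ln (real N)) powr (1 - \<epsilon>)))"
      using L_count_bound by blast
    show "AE x in lebesgue_on {0..1}. limsup (\<lambda>N. ereal (\<bar>\<Sum>k=1..N. dyadic_cos d (real (run_seq k) * x)\<bar> /
            sqrt (2 * real N * ln (ln (real N))))) \<ge> ereal (K * norm_2 (dyadic_cos d))"
      by (rule run_seq_limsup[OF event_probabilities_diverge P_ratio_summable eventually_large_sum])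
  qed
qed

end
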